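(* Let $p$ be a prime, $k$ an algebraically closed field of characteristic $p$, $P$ a cyclic group of order $q=p^t$ with a generator $x$, and $E$ a $p'$-subgroup of $\mathrm{Aut}(P)$ of order $e$, with a generator sending $x$ to $x^s$. For $m=0,\ldots,q-1$, let $D_m$ denote the derivation on $kP$ that sends $$x\longmapsto\sum_{i=0}^{e-1}s^i x^{(m-1)s^{-i}+1}.$$ Define an equivalence relation on $\{D_0,\ldots,D_{q-1}\}$ by $D_m\sim D_n$ if and only if $n=(m-1)s^{-i}+1$ (read modulo $q$) for some $i=0,\ldots,e-1$. Then the following hold. (i) If $E$ is non-trivial, then for all $m$, $D_m(x)\in J(kP)$. (ii) The set of equivalence class representatives of $\sim$ on $\{D_0,\ldots,D_{q-1}\}$ forms a $k$-basis for $HH^1(kP)^{E}$ as a Lie algebra. (iii) Let $p>2$ and $t=1$, so that $P$ is cyclic of order $p$, and let $E$ have order $p-1$. Then $HH^1(kP)^{E}$ has a $p$-toral basis.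
   Context: Exponents of $x$ are read modulo $q$, and $s^{-1}$ denotes the inverse of $s$ modulo $q$. $J(kP)$ is the Jacobson radical of $kP$ (the augmentation ideal). Since $kP$ is commutative, $HH^1(kP)=\mathrm{Der}(kP)$, the Lie algebra of $k$-linear derivations of $kP$ with commutator bracket. The group $E$ acts on it by $({}^{z}d)(a)=z\cdot d(z^{-1}\cdot a)$ for $z\in E$, $a\in kP$, and $HH^1(kP)^E$ is the Lie subalgebra of fixed points. A $p$-toral basis is a $k$-basis consisting of pairwise commuting derivations $D$ with $D^p=D$ ($p$-fold composition).
   Formalization: In (ii) the basis is the set of nonzero class representatives: for non-trivial E, D_1 = 0 forms its own class, so the set as stated contains 0; it is also shown that no other D_m vanishes. t ≥ 1 is assumed, since for t = 0 the derivation D_0 does not exist. *)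

theory Defs
  imports
    "HOL-Library.Poly_Mapping"
    "HOL-Library.Function_Algebras"
    "HOL-Number_Theory.Modular_Inverse"
    "HOL-Algebra.Algebra"
    "HOL-Algebra.Algebraic_Closure_Type"
begin

text \<open>
  The abelian group \<open>P\<close> is the additive group of a type \<open>'g\<close> of class \<open>ab_group_add\<close>, because the
  group algebra \<open>kP\<close> is then the convolution ring \<open>'g \<Rightarrow>\<^sub>0 'k\<close> of the library.  The record below
  gives \<open>P\<close> as a multiplicatively written group, whose automorphism group is \<open>AutoGroup grp\<close>.
\<close>

definition grp :: "'g::ab_group_add monoid" where
  "grp = \<lparr>carrier = UNIV, monoid.mult = (+), one = 0\<rparr>"

text \<open>A group element as an element of \<open>kP\<close>; in \<open>kP\<close> products and powers of group elements are
  written multiplicatively, \<open>gel (g + h) = gel g * gel h\<close>.\<close>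

definition gel :: "'g \<Rightarrow> 'g::ab_group_add \<Rightarrow>\<^sub>0 'k::comm_ring_1" where
  "gel g = Poly_Mapping.single g 1"

definition kscale :: "'k::comm_ring_1 \<Rightarrow> ('g::ab_group_add \<Rightarrow>\<^sub>0 'k) \<Rightarrow> 'g \<Rightarrow>\<^sub>0 'k" where
  "kscale c a = Poly_Mapping.single 0 c * a"

definition endo_scale ::
    "'k::comm_ring_1 \<Rightarrow> (('g::ab_group_add \<Rightarrow>\<^sub>0 'k) \<Rightarrow> 'g \<Rightarrow>\<^sub>0 'k) \<Rightarrow> ('g \<Rightarrow>\<^sub>0 'k) \<Rightarrow> 'g \<Rightarrow>\<^sub>0 'k" where
  "endo_scale c d = (\<lambda>a. kscale c (d a))"

global_interpretation kP: vector_space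
  "kscale :: 'k::field \<Rightarrow> ('g::ab_group_add \<Rightarrow>\<^sub>0 'k) \<Rightarrow> 'g \<Rightarrow>\<^sub>0 'k"
  by unfold_locales
    (simp_all add: kscale_def distrib_left distrib_right single_add mult_single flip: mult.assoc)

text \<open>Addition of endomaps is pointwise (from the function-algebra library).\<close>

global_interpretation kEnd: vector_space
  "endo_scale :: 'k::field \<Rightarrow> (('g::ab_group_add \<Rightarrow>\<^sub>0 'k) \<Rightarrow> 'g \<Rightarrow>\<^sub>0 'k) \<Rightarrow> ('g \<Rightarrow>\<^sub>0 'k) \<Rightarrow> 'g \<Rightarrow>\<^sub>0 'k"
  by unfold_locales
    (simp_all add: endo_scale_def fun_eq_iff kP.scale_right_distrib kP.scale_left_distrib)

definition is_basis ::
    "(('g::ab_group_add \<Rightarrow>\<^sub>0 'k::field) \<Rightarrow> 'g \<Rightarrow>\<^sub>0 'k) set \<Rightarrow> (('g \<Rightarrow>\<^sub>0 'k) \<Rightarrow> 'g \<Rightarrow>\<^sub>0 'k) set \<Rightarrow> bool" where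
  "is_basis B V \<longleftrightarrow> B \<subseteq> V \<and> kEnd.independent B \<and> kEnd.span B = V"

definition jacobson_radical :: "'r::comm_ring_1 set" where
  "jacobson_radical = \<Inter> {M. maximalideal M (ring_of_type_algebra :: 'r ring)}"

text \<open>\<open>kP\<close> is commutative, so there are no nonzero inner derivations and \<open>HH\<^sup>1(kP) = Der(kP)\<close>.\<close>

definition HH1 :: "(('g::ab_group_add \<Rightarrow>\<^sub>0 'k::field) \<Rightarrow> 'g \<Rightarrow>\<^sub>0 'k) set" where
  "HH1 = {d. Vector_Spaces.linear kscale kscale d \<and> (\<forall>a b. d (a * b) = a * d b + d a * b)}"

definition lie_bracket ::
    "('a \<Rightarrow> 'a) \<Rightarrow> ('a \<Rightarrow> 'a) \<Rightarrow> 'a \<Rightarrow> 'a::ab_group_add" where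
  "lie_bracket d d' = (\<lambda>a. d (d' a) - d' (d a))"

definition lie_subalgebra :: "(('g::ab_group_add \<Rightarrow>\<^sub>0 'k::field) \<Rightarrow> 'g \<Rightarrow>\<^sub>0 'k) set \<Rightarrow> bool" where
  "lie_subalgebra V \<longleftrightarrow>
     V \<subseteq> HH1 \<and> kEnd.subspace V \<and> (\<forall>d\<in>V. \<forall>d'\<in>V. lie_bracket d d' \<in> V)"

definition act :: "('g \<Rightarrow> 'g) \<Rightarrow> ('g::ab_group_add \<Rightarrow>\<^sub>0 'k::field) \<Rightarrow> 'g \<Rightarrow>\<^sub>0 'k" where
  "act z a = (\<Sum>g\<in>Poly_Mapping.keys a. kscale (Poly_Mapping.lookup a g) (gel (z g)))"

definition act_der ::
    "('g \<Rightarrow> 'g) \<Rightarrow> (('g::ab_group_add \<Rightarrow>\<^sub>0 'k::field) \<Rightarrow> 'g \<Rightarrow>\<^sub>0 'k) \<Rightarrow> ('g \<Rightarrow>\<^sub>0 'k) \<Rightarrow> 'g \<Rightarrow>\<^sub>0 'k" where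
  "act_der z d = (\<lambda>a. act z (d (act (inv\<^bsub>AutoGroup grp\<^esub> z) a)))"

definition HH1_fixed ::
    "('g \<Rightarrow> 'g) set \<Rightarrow> (('g::ab_group_add \<Rightarrow>\<^sub>0 'k::field) \<Rightarrow> 'g \<Rightarrow>\<^sub>0 'k) set" where
  "HH1_fixed E = {d \<in> HH1. \<forall>z\<in>E. act_der z d = d}"

text \<open>The exponent \<open>(m - 1) s\<^sup>-\<^sup>i + 1\<close>, reduced to \<open>{0..<q}\<close>; the computation takes place in
  \<open>int\<close> so that \<open>m = 0\<close> causes no truncation.\<close>

definition Dexp :: "nat \<Rightarrow> int \<Rightarrow> nat \<Rightarrow> nat \<Rightarrow> nat" where
  "Dexp q s m i = nat (((int m - 1) * modular_inverse (int q) s ^ i + 1) mod int q)"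

definition Dimage ::
    "nat \<Rightarrow> nat \<Rightarrow> int \<Rightarrow> 'g \<Rightarrow> nat \<Rightarrow> 'g::ab_group_add \<Rightarrow>\<^sub>0 'k::field" where
  "Dimage q e s x m = (\<Sum>i<e. kscale (of_int s ^ i) (gel x ^ Dexp q s m i))"

definition D ::
    "nat \<Rightarrow> nat \<Rightarrow> int \<Rightarrow> 'g \<Rightarrow> nat \<Rightarrow> ('g::ab_group_add \<Rightarrow>\<^sub>0 'k::field) \<Rightarrow> 'g \<Rightarrow>\<^sub>0 'k" where
  "D q e s x m = (THE d. d \<in> HH1 \<and> d (gel x) = Dimage q e s x m)"

definition Dsim ::
    "nat \<Rightarrow> nat \<Rightarrow> int \<Rightarrow> 'g \<Rightarrow>
      ((('g::ab_group_add \<Rightarrow>\<^sub>0 'k::field) \<Rightarrow> 'g \<Rightarrow>\<^sub>0 'k) \<times> (('g \<Rightarrow>\<^sub>0 'k) \<Rightarrow> 'g \<Rightarrow>\<^sub>0 'k)) set" where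
  "Dsim q e s x =
     {(D q e s x m, D q e s x n) | m n. m < q \<and> n < q \<and> (\<exists>i<e. n = Dexp q s m i)}"

text \<open>\<open>A // r\<close> consists of the equivalence classes; \<open>R\<close> meets each in exactly one element.\<close>

definition class_representatives :: "'a set \<Rightarrow> ('a \<times> 'a) set \<Rightarrow> 'a set \<Rightarrow> bool" where
  "class_representatives A r R \<longleftrightarrow> R \<subseteq> A \<and> (\<forall>C \<in> A // r. \<exists>!d. d \<in> R \<inter> C)"

text \<open>\<open>d ^^ p\<close> is the \<open>p\<close>-fold composition; \<open>d ^ p\<close> would be the pointwise power.\<close>

definition p_toral_basis ::
    "nat \<Rightarrow> (('g::ab_group_add \<Rightarrow>\<^sub>0 'k::field) \<Rightarrow> 'g \<Rightarrow>\<^sub>0 'k) set \<Rightarrow> (('g \<Rightarrow>\<^sub>0 'k) \<Rightarrow> 'g \<Rightarrow>\<^sub>0 'k) set \<Rightarrow> bool" where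
  "p_toral_basis p B V \<longleftrightarrow>
     is_basis B V \<and> (\<forall>d\<in>B. \<forall>d'\<in>B. d \<circ> d' = d' \<circ> d) \<and> (\<forall>d\<in>B. d ^^ p = d)"

end

theory Submission
  imports Defs
begin

text \<open>
  Let \<open>\<theta>\<close> be the Euler derivation \<open>x\<^sup>n \<mapsto> n x\<^sup>n\<close> of \<open>kP\<close>.  Since \<open>x\<close> is a unit, every derivation
  \<open>d\<close> equals \<open>w \<theta>\<close> with \<open>w = x\<^sup>-\<^sup>1 d(x)\<close> (\<open>HH1_eq_der\<close>), so derivations are elements of \<open>kP\<close>.  An
  automorphism \<open>y\<close> with \<open>y(x) = x\<^sup>r\<close> satisfies \<open>\<theta> \<circ> y = r (y \<circ> \<theta>)\<close>, whence \<open>w \<theta>\<close> is invariant under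
  the generator \<open>z\<close> of \<open>E\<close> if and only if \<open>z(w) = s w\<close> (\<open>HH1_fixed_eq\<close>).  Here \<open>P\<close> is written
  multiplicatively; in the formal text it is additive, \<open>gx n\<close> standing for \<open>x\<^sup>n\<close>, and \<open>zi\<close> is the
  inverse of \<open>z\<close>.

  For \<open>a \<in> P\<close> put \<open>W\<^sub>a = \<Sum>\<^sub>i s\<^sup>i z\<^sup>-\<^sup>i(a)\<close>, summed over \<open>i < e\<close>.  Then \<open>D\<^sub>m = W\<^sub>a \<theta>\<close> for
  \<open>a = x\<^sup>m\<^sup>-\<^sup>1\<close>, and \<open>D\<^sub>m \<sim> D\<^sub>n\<close> says that \<open>x\<^sup>m\<^sup>-\<^sup>1\<close> and \<open>x\<^sup>n\<^sup>-\<^sup>1\<close> lie in the same \<open>E\<close>-orbit.  As \<open>e\<close> is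
  prime to \<open>p\<close>, the integer \<open>s\<close> has order \<open>e\<close> not only modulo \<open>q\<close> but also modulo \<open>p\<close>
  (\<open>s_pow_cong_p\<close>).  Hence the elements \<open>s\<^sup>i\<close> of \<open>k\<close>, \<open>i < e\<close>, are distinct, and \<open>E\<close> acts freely on
  \<open>P - {1}\<close> (\<open>z_pow_fixed_point\<close>): for \<open>a \<noteq> 1\<close> the element \<open>W\<^sub>a\<close> has the \<open>e\<close> coefficients \<open>s\<^sup>i\<close> on the
  orbit of \<open>a\<close> and is zero elsewhere, whereas \<open>W\<^sub>1 = \<Sum>\<^sub>i s\<^sup>i\<close> vanishes if \<open>e > 1\<close>.

  (i) If \<open>e > 1\<close>, the augmentation of \<open>D\<^sub>m(x) = W\<^sub>a x\<close> is \<open>\<Sum>\<^sub>i s\<^sup>i = 0\<close>, and elements of augmentation \<open>0\<close> are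
  nilpotent, because \<open>u\<^sup>q = \<epsilon>(u)\<^sup>q\<close> for all \<open>u\<close> in \<open>kP\<close>.

  (ii) The nonzero \<open>W\<^sub>a\<close> of different orbits have disjoint supports and are thus independent.  Along
  an orbit the \<open>W\<^sub>a\<close> are proportional, and if \<open>z(w) = s w\<close>, averaging gives
  \<open>e w = \<Sum>\<^sub>g w\<^sub>g W\<^sub>g\<close> (\<open>average_orbit_sums\<close>); as \<open>e\<close> is invertible in \<open>k\<close>, the \<open>W\<^sub>a\<close> span.

  (iii) If \<open>q = p\<close> and \<open>e = p - 1\<close>, there is only one nontrivial orbit and the invariants are the
  multiples of \<open>D = D\<^sub>0\<close>.  By the Leibniz formula the iterate \<open>D\<^sup>p\<close> is again an invariant derivation,
  so \<open>D\<^sup>p = c D\<close>.  On the one-dimensional space \<open>J/J\<^sup>2\<close>, \<open>J\<close> the augmentation ideal, \<open>D\<close> acts as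
  multiplication by \<open>- e = 1\<close>, so \<open>c = 1\<close> and \<open>D\<close> itself is toral.
\<close>

section \<open>Linear algebra in a group algebra\<close>

lemma kscale_single [simp]: "kscale c (Poly_Mapping.single g d) = Poly_Mapping.single g (c * d)"
  by (simp add: kscale_def mult_single)

lemma kscale_add: "kscale c (a + b) = kscale c a + kscale c b"
  by (simp add: kscale_def distrib_left)

lemma kscale_zero [simp]: "kscale c 0 = 0"
  by (simp add: kscale_def)

lemma kscale_sum: "kscale c (sum f A) = (\<Sum>i\<in>A. kscale c (f i))"
  by (simp add: kscale_def sum_distrib_left)

lemma kscale_kscale [simp]: "kscale c (kscale d a) = kscale (c * d) a"
  by (simp add: kscale_def mult_single flip: mult.assoc)

lemma kscale_one [simp]: "kscale 1 a = a"
  by (simp add: kscale_def)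

lemma kscale_mult_left: "kscale c a * b = kscale c (a * b)"
  by (simp add: kscale_def mult.assoc)

lemma kscale_mult_right: "a * kscale c b = kscale c (a * b)"
  by (simp add: kscale_def mult.left_commute)

lemma gel_add: "gel (g + h) = gel g * gel h"
  by (simp add: gel_def mult_single)

lemma gel_zero [simp]: "gel 0 = 1"
  by (simp add: gel_def)

lemma group_algebra_induct [case_names zero single add]:
  assumes "P 0" and "\<And>g c. P (Poly_Mapping.single g c)"
    and "\<And>a b. P a \<Longrightarrow> P b \<Longrightarrow> P (a + b)"
  shows "P (a :: 'g \<Rightarrow>\<^sub>0 'k::comm_monoid_add)"
proof (induction a rule: update_induct)
  case const
  show ?case using assms(1) .
next
  case (update f a b)
  have "Poly_Mapping.update a b f = f + Poly_Mapping.single a b"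
    using update(1)
    by (intro poly_mapping_eqI) (auto simp: lookup_update lookup_add lookup_single in_keys_iff)
  then show ?case using assms(2,3) update(3) by simp
qed

text \<open>The monomials generate the group algebra additively, so linear identities, and by a double
  application bilinear ones, are reduced to computations with single group elements.\<close>

lemma additive_eqI:
  assumes f: "\<And>a b. f (a + b) = f a + f b" and h: "\<And>a b. h (a + b) = h a + h b"
    and eq: "\<And>g c. f (Poly_Mapping.single g c) = h (Poly_Mapping.single g c)"
  shows "f a = (h (a :: 'g \<Rightarrow>\<^sub>0 'k::comm_monoid_add) :: 'b::cancel_comm_monoid_add)"
proof (induction a rule: group_algebra_induct)
  case zero
  have "f 0 = 0" "h 0 = 0"
    using f[of 0 0] h[of 0 0] by simp_all
  then show ?case by simp
qed (simp_all add: f h eq)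

lemma additive_zero:
  fixes f :: "'a::comm_monoid_add \<Rightarrow> 'b::cancel_comm_monoid_add"
  assumes "\<And>a b. f (a + b) = f a + f b"
  shows "f 0 = 0"
  using assms[of 0 0] by simp

lemma additive_sum:
  fixes f :: "'a::comm_monoid_add \<Rightarrow> 'b::cancel_comm_monoid_add"
  assumes "\<And>a b. f (a + b) = f a + f b"
  shows "f (sum u A) = (\<Sum>i\<in>A. f (u i))"
  by (induction A rule: infinite_finite_induct) (simp_all add: assms additive_zero[OF assms])

lemma lookup_single_times:
  "Poly_Mapping.lookup (Poly_Mapping.single h c * a) g
   = c * Poly_Mapping.lookup (a :: 'g::ab_group_add \<Rightarrow>\<^sub>0 'k::comm_ring_1) (g - h)"
proof (rule additive_eqI[where a = a])
  fix g' d
  show "Poly_Mapping.lookup (Poly_Mapping.single h c * Poly_Mapping.single g' d) g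
        = c * Poly_Mapping.lookup (Poly_Mapping.single g' d) (g - h)"
    by (auto simp: mult_single lookup_single when_def)
qed (simp_all add: lookup_add distrib_left)

lemma lookup_kscale [simp]:
  "Poly_Mapping.lookup (kscale c a) g = c * Poly_Mapping.lookup a g"
  by (simp add: kscale_def lookup_single_times)

lemma of_nat_times_conv: "of_nat n * a = kscale (of_nat n) a"
  by (simp add: kscale_def)

lemma kscale_gel: "kscale c (gel g) = Poly_Mapping.single g c"
  by (simp add: gel_def)

lemma sum_singles:
  assumes "finite (UNIV :: 'g::ab_group_add set)"
  shows "(\<Sum>g\<in>UNIV. Poly_Mapping.single g (Poly_Mapping.lookup a g)) = (a :: 'g \<Rightarrow>\<^sub>0 'k::comm_ring_1)"
  by (intro poly_mapping_eqI) (simp add: lookup_sum lookup_single when_def assms)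

text \<open>The characteristic passes from the coefficients to the group algebra, so that the freshman's
  dream is available there.\<close>

lemma CHAR_group_algebra: "CHAR('g::ab_group_add \<Rightarrow>\<^sub>0 'k::comm_ring_1) = CHAR('k)"
proof (rule CHAR_eqI)
  have *: "of_nat n = (0 :: 'g \<Rightarrow>\<^sub>0 'k) \<longleftrightarrow> of_nat n = (0 :: 'k)" for n
  proof
    assume "of_nat n = (0 :: 'g \<Rightarrow>\<^sub>0 'k)"
    then have "Poly_Mapping.lookup (of_nat n :: 'g \<Rightarrow>\<^sub>0 'k) 0 = 0" by simp
    then show "of_nat n = (0 :: 'k)" by (simp add: lookup_of_nat)
  next
    assume "of_nat n = (0 :: 'k)"
    then have "Poly_Mapping.single (0 :: 'g) (of_nat n :: 'k) = 0" by simp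
    then show "of_nat n = (0 :: 'g \<Rightarrow>\<^sub>0 'k)" by simp
  qed
  show "of_nat CHAR('k) = (0 :: 'g \<Rightarrow>\<^sub>0 'k)"
    unfolding * by simp
  show "CHAR('k) dvd n" if "of_nat n = (0 :: 'g \<Rightarrow>\<^sub>0 'k)" for n
    using that unfolding * by (simp add: of_nat_eq_0_iff_char_dvd)
qed

section \<open>The augmentation and the action of automorphisms\<close>

definition augmentation :: "('g \<Rightarrow>\<^sub>0 'k) \<Rightarrow> 'k::comm_ring_1" where
  "augmentation a = (\<Sum>g\<in>Poly_Mapping.keys a. Poly_Mapping.lookup a g)"

lemma augmentation_single [simp]: "augmentation (Poly_Mapping.single g c) = c"
  by (simp add: augmentation_def)

lemma augmentation_gel [simp]: "augmentation (gel g) = 1"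
  by (simp add: gel_def)

lemma augmentation_add: "augmentation (a + b) = augmentation a + augmentation b"
  unfolding augmentation_def by (rule setsum_keys_plus_distrib) simp_all

lemma augmentation_mult:
  "augmentation (a * b) = augmentation a * augmentation (b :: 'g::ab_group_add \<Rightarrow>\<^sub>0 'k::comm_ring_1)"
proof (rule additive_eqI[where a = a])
  fix g c
  show "augmentation (Poly_Mapping.single g c * b)
        = augmentation (Poly_Mapping.single g c) * augmentation b"
    by (rule additive_eqI[where a = b])
      (simp_all add: mult_single distrib_left augmentation_add)
qed (simp_all add: augmentation_add distrib_right)

lemma augmentation_kscale [simp]: "augmentation (kscale c a) = c * augmentation a"
  by (simp add: kscale_def augmentation_mult)

lemmas augmentation_sum = additive_sum[of augmentation, OF augmentation_add]

lemma act_single [simp]: "act z (Poly_Mapping.single g c) = Poly_Mapping.single (z g) c"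
  by (simp add: act_def gel_def)

lemma act_gel [simp]: "act z (gel g) = gel (z g)"
  by (simp add: gel_def)

lemma act_add: "act z (a + b) = act z a + act z b"
  unfolding act_def by (rule setsum_keys_plus_distrib) (simp_all add: kP.scale_left_distrib)

lemmas act_sum = additive_sum[of "act z" for z, OF act_add]

lemma act_kscale: "act z (kscale c a) = kscale c (act z a)"
  by (rule additive_eqI[where a = a]) (simp_all add: act_add kscale_add)

lemma act_mult:
  assumes "\<And>g h. z (g + h) = z g + z h"
  shows "act z (a * b) = act z a * act z b"
proof (rule additive_eqI[where a = a])
  fix g c
  show "act z (Poly_Mapping.single g c * b) = act z (Poly_Mapping.single g c) * act z b"
    by (rule additive_eqI[where a = b]) (simp_all add: mult_single distrib_left act_add assms)
qed (simp_all add: act_add distrib_right)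

lemma act_act: "act y (act z a) = act (y \<circ> z) a"
  by (rule additive_eqI[where a = a]) (simp_all add: act_add)

lemma act_id [simp]: "act id a = a"
  by (rule additive_eqI[where a = a]) (simp_all add: act_add)

section \<open>Derivations\<close>

lemma HH1_I:
  assumes "\<And>a b. d (a + b) = d a + d b" "\<And>c a. d (kscale c a) = kscale c (d a)"
    and "\<And>a b. d (a * b) = a * d b + d a * b"
  shows "d \<in> HH1"
proof -
  have "Vector_Spaces.linear kscale kscale d"
    by (intro Vector_Spaces.linear.intro module_hom.intro module_hom_axioms.intro
      kP.vector_space_axioms kP.module_axioms assms)
  then show ?thesis using assms(3) by (simp add: HH1_def)
qed

lemma HH1_D:
  assumes "d \<in> HH1"
  shows HH1_add: "d (a + b) = d a + d b"
    and HH1_kscale: "d (kscale c a) = kscale c (d a)"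
    and HH1_mult: "d (a * b) = a * d b + d a * b"
proof -
  have lin: "Vector_Spaces.linear kscale kscale d" and prod: "\<And>a b. d (a * b) = a * d b + d a * b"
    using assms by (simp_all add: HH1_def)
  interpret d: Vector_Spaces.linear kscale kscale d by (rule lin)
  show "d (a + b) = d a + d b" "d (kscale c a) = kscale c (d a)" "d (a * b) = a * d b + d a * b"
    by (rule d.add d.scale prod)+
qed

lemma HH1_power:
  assumes "d \<in> HH1"
  shows "d (a ^ Suc n) = of_nat (Suc n) * a ^ n * d a"
proof (induction n)
  case (Suc n)
  have "d (a ^ Suc (Suc n)) = a * d (a ^ Suc n) + d a * a ^ Suc n"
    by (simp only: power_Suc[of a "Suc n"] HH1_mult[OF assms])
  then show ?case unfolding Suc by (simp add: algebra_simps)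
qed simp

lemma HH1_one:
  assumes "d \<in> HH1"
  shows "d 1 = 0"
  using HH1_mult[OF assms, of 1 1] by simp

lemma HH1_funpow_mult:
  assumes "d \<in> HH1"
  shows "(d ^^ n) (a * b) = (\<Sum>k\<le>n. of_nat (n choose k) * ((d ^^ k) a * (d ^^ (n - k)) b))"
proof (induction n)
  case (Suc n)
  have d_nat: "d (of_nat m * u) = of_nat m * d u" for m u
    by (simp add: of_nat_times_conv HH1_kscale[OF assms])
  have d_sum: "d (sum u A) = (\<Sum>i\<in>A. d (u i))" for u and A :: "nat set"
    by (rule additive_sum) (rule HH1_add[OF assms])
  let ?t = "\<lambda>k l. (d ^^ k) a * (d ^^ l) b"
  have "(d ^^ Suc n) (a * b) = (\<Sum>k\<le>n. of_nat (n choose k) * d (?t k (n - k)))"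
    by (simp only: funpow.simps o_apply Suc d_sum d_nat)
  also have "\<dots> = (\<Sum>k\<le>n. of_nat (n choose k) * ?t (Suc k) (n - k)) + (\<Sum>k\<le>n. of_nat (n choose k) * ?t k (Suc n - k))"
    by (simp add: HH1_mult[OF assms] distrib_left sum.distrib Suc_diff_le add.commute)
  also have "(\<Sum>k\<le>n. of_nat (n choose k) * ?t k (Suc n - k))
      = ?t 0 (Suc n) + (\<Sum>k<n. of_nat (n choose Suc k) * ?t (Suc k) (n - k))"
    by (simp add: sum.atMost_shift)
  also have "(\<Sum>k<n. of_nat (n choose Suc k) * ?t (Suc k) (n - k))
      = (\<Sum>k\<le>n. of_nat (n choose Suc k) * ?t (Suc k) (n - k))"
    by (intro sum.mono_neutral_left) (auto simp: binomial_eq_0)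
  also have "(\<Sum>k\<le>n. of_nat (n choose k) * ?t (Suc k) (n - k))
        + (?t 0 (Suc n) + (\<Sum>k\<le>n. of_nat (n choose Suc k) * ?t (Suc k) (n - k)))
      = ?t 0 (Suc n) + (\<Sum>k\<le>n. of_nat (Suc n choose Suc k) * ?t (Suc k) (n - k))"
    by (simp add: sum.distrib distrib_right)
  also have "\<dots> = (\<Sum>k\<le>Suc n. of_nat (Suc n choose k) * ?t k (Suc n - k))"
    by (subst sum.atMost_Suc_shift) simp
  finally show ?case .
qed simp

text \<open>In characteristic \<open>p\<close> the inner terms of the Leibniz formula for the \<open>p\<close>-th iterate carry
  binomial coefficients divisible by \<open>p\<close>; this is why derivations are closed under \<open>p\<close>-th
  composition powers.\<close>

lemma HH1_funpow_char:
  fixes d :: "('g::ab_group_add \<Rightarrow>\<^sub>0 'k::field) \<Rightarrow> 'g \<Rightarrow>\<^sub>0 'k"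
  assumes "d \<in> HH1" and p: "Factorial_Ring.prime p" "CHAR('k) = p"
  shows "d ^^ p \<in> HH1"
proof (rule HH1_I)
  show "(d ^^ p) (a + b) = (d ^^ p) a + (d ^^ p) b" for a b
    by (induction p) (simp_all add: HH1_add[OF assms(1)])
  show "(d ^^ p) (kscale c a) = kscale c ((d ^^ p) a)" for c a
    by (induction p) (simp_all add: HH1_kscale[OF assms(1)])
  show "(d ^^ p) (a * b) = a * (d ^^ p) b + (d ^^ p) a * b" for a b
  proof -
    have p0: "p > 0" using p(1) by (simp add: prime_gt_0_nat)
    have "(d ^^ p) (a * b) = (\<Sum>k\<le>p. of_nat (p choose k) * ((d ^^ k) a * (d ^^ (p - k)) b))"
      by (rule HH1_funpow_mult[OF assms(1)])
    also have "\<dots> = (\<Sum>k\<in>{0, p}. of_nat (p choose k) * ((d ^^ k) a * (d ^^ (p - k)) b))"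
    proof (intro sum.mono_neutral_right ballI)
      fix k assume "k \<in> {..p} - {0, p}"
      then have "p dvd (p choose k)"
        using p by (intro dvd_choose_prime) auto
      then have "of_nat (p choose k) = (0 :: 'g \<Rightarrow>\<^sub>0 'k)"
        using p(2) by (simp add: of_nat_eq_0_iff_char_dvd CHAR_group_algebra)
      then show "of_nat (p choose k) * ((d ^^ k) a * (d ^^ (p - k)) b) = 0" by simp
    qed auto
    also have "\<dots> = a * (d ^^ p) b + (d ^^ p) a * b"
      using p0 by simp
    finally show ?thesis .
  qed
qed

lemma HH1_lie_bracket:
  assumes "d \<in> HH1" "d' \<in> HH1"
  shows "lie_bracket d d' \<in> HH1"
proof (rule HH1_I)
  show "lie_bracket d d' (a + b) = lie_bracket d d' a + lie_bracket d d' b" for a b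
    unfolding lie_bracket_def HH1_add[OF assms(1)] HH1_add[OF assms(2)] by (rule add_diff_add)
  show "lie_bracket d d' (kscale c a) = kscale c (lie_bracket d d' a)" for c a
    unfolding lie_bracket_def HH1_kscale[OF assms(1)] HH1_kscale[OF assms(2)]
    by (rule kP.scale_right_diff_distrib [symmetric])
  show "lie_bracket d d' (a * b) = a * lie_bracket d d' b + lie_bracket d d' a * b" for a b
    unfolding lie_bracket_def HH1_add[OF assms(1)] HH1_add[OF assms(2)] HH1_mult[OF assms(1)]
      HH1_mult[OF assms(2)] by (simp only: algebra_simps)
qed

section \<open>Nilpotency of the augmentation ideal\<close>

text \<open>In \<open>kP\<close> every element satisfies \<open>a ^ q = \<epsilon>(a) ^ q\<close>, because \<open>q\<close>-th powers are additive and
  \<open>g ^ q = 1\<close>.  An element of augmentation \<open>0\<close> is therefore nilpotent and lies in every maximal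
  ideal.\<close>

lemma augmentation_zero_in_jacobson_radical:
  fixes a :: "'g::ab_group_add \<Rightarrow>\<^sub>0 'k::field"
  assumes p: "Factorial_Ring.prime CHAR('k)" and q: "q = CHAR('k) ^ t"
    and exponent: "\<And>g :: 'g. gel g ^ q = (1 :: 'g \<Rightarrow>\<^sub>0 'k)"
    and a: "augmentation a = 0"
  shows "a \<in> jacobson_radical"
proof -
  have q0: "q > 0" using p q by (simp add: prime_gt_0_nat)
  have dream: "(u + v) ^ q = u ^ q + v ^ q" for u v :: "'g \<Rightarrow>\<^sub>0 'k"
    by (rule freshmans_dream'[where n = t]) (simp_all add: p q CHAR_group_algebra)
  have dream_k: "(u + v) ^ q = u ^ q + v ^ q" for u v :: 'k
    by (rule freshmans_dream'[where n = t]) (simp_all add: p q)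
  have "a ^ q = Poly_Mapping.single 0 (augmentation a ^ q)"
  proof (rule additive_eqI[where a = a])
    fix g :: 'g and c :: 'k
    have pow: "Poly_Mapping.single 0 c ^ n = Poly_Mapping.single (0::'g) (c ^ n)" for n
      by (induction n) (simp_all add: mult_single)
    have "Poly_Mapping.single g c = Poly_Mapping.single 0 c * gel g"
      by (simp add: gel_def mult_single)
    then show "Poly_Mapping.single g c ^ q
        = Poly_Mapping.single 0 (augmentation (Poly_Mapping.single g c) ^ q)"
      by (simp add: power_mult_distrib exponent pow augmentation_mult)
  qed (simp_all add: dream dream_k augmentation_add single_add)
  then have nil: "a ^ q = 0" using a q0 by (simp add: power_0_left)
  interpret R: cring "ring_of_type_algebra :: ('g \<Rightarrow>\<^sub>0 'k) ring" ..
  have "a \<in> M" if M: "maximalideal M (ring_of_type_algebra :: ('g \<Rightarrow>\<^sub>0 'k) ring)" for M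
  proof -
    interpret primeideal M "ring_of_type_algebra :: ('g \<Rightarrow>\<^sub>0 'k) ring"
      using R.maximalideal_prime[OF M] .
    have pr: "u * v \<in> M \<Longrightarrow> u \<in> M \<or> v \<in> M" for u v
      using I_prime[of u v] by (simp add: ring_of_type_algebra_def)
    have one: "1 \<notin> M"
      using I_notcarr one_imp_carrier by (auto simp: ring_of_type_algebra_def)
    have "0 \<in> M"
      using additive_subgroup.zero_closed[OF additive_subgroup_axioms]
      by (simp add: ring_of_type_algebra_def)
    moreover have "a ^ n \<in> M \<Longrightarrow> a \<in> M" for n
      by (induction n) (use pr one in auto)
    ultimately show ?thesis using nil by metis
  qed
  then show ?thesis by (auto simp: jacobson_radical_def)
qed

section \<open>The cyclic group and the Euler derivation\<close>

lemma grp_simps [simp]: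
  "carrier grp = UNIV" "g \<otimes>\<^bsub>grp\<^esub> h = g + h" "\<one>\<^bsub>grp\<^esub> = 0"
  by (simp_all add: grp_def)

lemma group_grp: "Group.group (grp :: 'g::ab_group_add monoid)"
proof (rule groupI)
  show "\<exists>h\<in>carrier grp. h \<otimes>\<^bsub>grp\<^esub> g = \<one>\<^bsub>grp\<^esub>" for g :: 'g
    by (rule bexI[of _ "- g"]) simp_all
qed (simp_all add: add.assoc)

text \<open>The parameter \<open>field_type\<close> serves to fix the coefficient field \<open>k\<close>, which the other parameters
  do not mention.\<close>

locale cyclic_p_group_algebra =
  fixes p t q :: nat and x :: "'g::ab_group_add" and field_type :: "'k::field itself"
  assumes prime_p: "Factorial_Ring.prime p" and char_k: "CHAR('k) = p"
    and q_def: "q = p ^ t" and t_pos: "t \<ge> 1"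
    and order_P: "Coset.order (grp :: 'g monoid) = q"
    and generator: "generate grp {x} = carrier grp"
begin

definition gx :: "int \<Rightarrow> 'g" where
  "gx n = x [^]\<^bsub>grp\<^esub> n"

lemma p_ge_2: "p \<ge> 2"
  using prime_p by (rule prime_ge_2_nat)

lemma p_dvd_q: "p dvd q"
  using t_pos by (simp add: q_def dvd_power)

lemma q_ge_2: "q \<ge> 2"
proof -
  have "q > 0" using p_ge_2 by (simp add: q_def)
  then have "p \<le> q" using p_dvd_q by (rule dvd_imp_le[rotated])
  then show ?thesis using p_ge_2 by simp
qed

lemma finite_P: "finite (UNIV :: 'g set)" and card_P: "card (UNIV :: 'g set) = q"
  using order_P q_ge_2 by (auto simp: Coset.order_def card_ge_0_finite)

lemma gx_add: "gx (m + n) = gx m + gx n"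
  using group.int_pow_mult[OF group_grp, of x m n] by (simp add: gx_def)

lemma gx_0 [simp]: "gx 0 = 0"
  by (simp add: gx_def)

lemma gx_1 [simp]: "gx 1 = x"
  using group.int_pow_1[OF group_grp, of x] by (simp add: gx_def)

lemma gx_minus: "gx (- n) = - gx n"
  using gx_add[of n "- n"] by (simp add: eq_neg_iff_add_eq_0 add.commute)

lemma gx_diff: "gx (m - n) = gx m - gx n"
  using gx_add[of m "- n"] by (simp add: gx_minus)

lemma gx_surj: "\<exists>n. g = gx n"
  using group.generate_pow[OF group_grp, of x] generator by (auto simp: gx_def)

lemma gx_eq_iff: "gx m = gx n \<longleftrightarrow> [m = n] (mod int q)"
proof -
  have "group.ord grp x = q"
    using group.generate_pow_card[OF group_grp, of x] generator card_P by simp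
  then show ?thesis
    using group.int_pow_eq[OF group_grp, of x n m]
    by (auto simp: gx_def cong_iff_dvd_diff)
qed

lemma gel_x_power: "gel x ^ n = gel (gx (int n))"
  by (induction n) (simp_all add: gx_add gel_add)

lemma gel_exponent: "gel g ^ q = (1 :: 'g \<Rightarrow>\<^sub>0 'k)"
proof -
  obtain n where n: "g = gx n" using gx_surj by blast
  have "gel (gx n) ^ i = (gel (gx (int i * n)) :: 'g \<Rightarrow>\<^sub>0 'k)" for i
    by (induction i) (simp_all add: distrib_right gx_add gel_add)
  moreover have "gx (int q * n) = gx 0"
    unfolding gx_eq_iff by (simp add: cong_0_iff)
  ultimately show ?thesis by (simp add: n)
qed

lemma additive_map_gx:
  assumes add: "\<And>g h. y (g + h) = y g + y h" and "y x = gx r"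
  shows "y (gx n) = gx (r * n)"
proof (induction n rule: int_induct[of _ 0])
  case base
  show ?case using additive_zero[of y, OF add] by simp
next
  case (step1 i)
  then show ?case by (simp add: gx_add add assms(2) distrib_left)
next
  case (step2 i)
  have "y (gx i) = y (gx (i - 1)) + y x"
    by (simp flip: add add: gx_diff)
  then show ?case using step2 by (simp add: assms(2) right_diff_distrib gx_diff algebra_simps)
qed

text \<open>The discrete logarithm to the base \<open>x\<close> is defined modulo \<open>q\<close> only, but its image in \<open>k\<close>
  is well defined since \<open>p\<close> divides \<open>q\<close>.\<close>

definition dlog :: "'g \<Rightarrow> 'k" where
  "dlog g = of_int (SOME n. gx n = g)"

lemma of_int_cong_p: "of_int m = (of_int n :: 'k) \<longleftrightarrow> [m = n] (mod int p)"
  using of_int_eq_0_iff_char_dvd[of "m - n", where 'a = 'k] by (simp add: char_k cong_iff_dvd_diff)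

lemma of_int_cong_q: "[m = n] (mod int q) \<Longrightarrow> of_int m = (of_int n :: 'k)"
  unfolding of_int_cong_p using p_dvd_q cong_dvd_modulus by (metis int_dvd_int_iff)

lemma dlog_gx [simp]: "dlog (gx n) = of_int n"
proof -
  have "gx (SOME m. gx m = gx n) = gx n" by (rule someI) (rule refl)
  then show ?thesis
    unfolding dlog_def gx_eq_iff by (rule of_int_cong_q)
qed

lemma dlog_add: "dlog (g + h) = dlog g + dlog h"
  using gx_surj[of g] gx_surj[of h] dlog_gx by (metis gx_add of_int_add)

text \<open>The derivation of \<open>kP\<close> with \<open>x \<mapsto> x\<close>.\<close>

definition euler :: "('g \<Rightarrow>\<^sub>0 'k) \<Rightarrow> 'g \<Rightarrow>\<^sub>0 'k" where
  "euler = Poly_Mapping.mapp (\<lambda>g c. dlog g * c)"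

lemma lookup_euler: "Poly_Mapping.lookup (euler a) g = dlog g * Poly_Mapping.lookup a g"
  by (simp add: euler_def lookup_mapp when_def in_keys_iff)

lemma euler_single [simp]: "euler (Poly_Mapping.single g c) = Poly_Mapping.single g (dlog g * c)"
  by (rule poly_mapping_eqI) (simp add: lookup_euler lookup_single when_def)

lemma euler_gel: "euler (gel g) = kscale (dlog g) (gel g)"
  by (simp add: gel_def)

lemma euler_add: "euler (a + b) = euler a + euler b"
  by (rule poly_mapping_eqI) (simp add: lookup_euler lookup_add distrib_left)

lemma euler_kscale: "euler (kscale c a) = kscale c (euler a)"
  by (rule poly_mapping_eqI) (simp add: lookup_euler)

lemma euler_mult: "euler (a * b) = a * euler b + euler a * b"
proof (rule additive_eqI[where a = a])
  fix g c
  show "euler (Poly_Mapping.single g c * b)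
      = Poly_Mapping.single g c * euler b + euler (Poly_Mapping.single g c) * b"
    by (rule additive_eqI[where a = b])
      (simp_all add: mult_single euler_add dlog_add algebra_simps flip: single_add)
qed (simp_all add: euler_add algebra_simps)

text \<open>\<open>\<theta>\<close> multiplies a monomial by its exponent, which \<open>y\<close> changes from \<open>n\<close> to \<open>r n\<close>.\<close>

lemma euler_act:
  assumes "\<And>g h. y (g + h) = y g + y h" and "y x = gx r"
  shows "euler (act y a) = kscale (of_int r) (act y (euler a))"
proof (rule additive_eqI[where a = a])
  fix g c
  obtain n where "g = gx n" using gx_surj by blast
  then show "euler (act y (Poly_Mapping.single g c))
      = kscale (of_int r) (act y (euler (Poly_Mapping.single g c)))"
    by (simp add: additive_map_gx[of y, OF assms] mult.assoc)
qed (simp_all add: euler_add act_add kscale_add)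

section \<open>The derivations are the multiples of the Euler derivation\<close>

definition der :: "('g \<Rightarrow>\<^sub>0 'k) \<Rightarrow> ('g \<Rightarrow>\<^sub>0 'k) \<Rightarrow> 'g \<Rightarrow>\<^sub>0 'k" where
  "der w = (\<lambda>a. w * euler a)"

lemma der_HH1: "der w \<in> HH1"
  by (rule HH1_I)
    (simp_all add: der_def euler_add euler_kscale euler_mult kscale_mult_right algebra_simps)

lemma dlog_x [simp]: "dlog x = 1"
  using dlog_gx[of 1] by simp

lemma der_x: "der w (gel x) = w * gel x"
  by (simp add: der_def euler_gel)

lemma gel_unit [simp]: "gel (- g) * gel g = 1" "gel g * gel (- g) = 1"
  by (simp_all flip: gel_add)

lemma gel_conjugate [simp]: "gel (- g) * u * gel g = u"
proof -
  have "gel (- g) * u * gel g = u * (gel g * gel (- g))"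
    by (simp only: mult_ac)
  then show ?thesis by simp
qed

text \<open>A derivation is determined by its value at the generator, and \<open>gel (- x)\<close> is the inverse of
  the generator in \<open>kP\<close>.\<close>

lemma HH1_eq_der:
  assumes "d \<in> HH1"
  shows "d = der (gel (- x) * d (gel x))"
proof
  fix a
  show "d a = der (gel (- x) * d (gel x)) a"
  proof (rule additive_eqI[where a = a])
    fix g c
    obtain n where "g = gx n" using gx_surj by blast
    moreover have "gx n = gx (int (nat (n mod int q)))"
      unfolding gx_eq_iff using q_ge_2 by (simp add: cong_def)
    ultimately obtain n where n: "g = gx (int n)" by blast
    have "d (gel g) = der (gel (- x) * d (gel x)) (gel g)"
    proof (cases n)
      case 0
      then show ?thesis
        using HH1_one[OF assms] HH1_one[OF der_HH1] n by simp
    next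
      case (Suc m)
      have g: "gel g = gel x ^ Suc m" by (simp only: n Suc gel_x_power)
      have "d (gel g) = of_nat (Suc m) * gel x ^ m * d (gel x)"
        unfolding g by (rule HH1_power[OF assms])
      also have "\<dots> = of_nat (Suc m) * gel x ^ m * der (gel (- x) * d (gel x)) (gel x)"
        by (simp add: der_x)
      also have "\<dots> = der (gel (- x) * d (gel x)) (gel g)"
        unfolding g by (rule HH1_power[OF der_HH1, symmetric])
      finally show ?thesis .
    qed
    then show "d (Poly_Mapping.single g c) = der (gel (- x) * d (gel x)) (Poly_Mapping.single g c)"
      by (simp only: HH1_kscale[OF assms] HH1_kscale[OF der_HH1] flip: kscale_gel)
  qed (use HH1_add[OF assms] HH1_add[OF der_HH1] in blast)+
qed

lemma der_inject: "der w = der w' \<longleftrightarrow> w = w'"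
proof
  assume "der w = der w'"
  then have "w * gel x * gel (- x) = w' * gel x * gel (- x)"
    by (metis der_x)
  then show "w = w'" by (simp add: mult.assoc)
qed simp

lemma der_zero: "der w = 0 \<longleftrightarrow> w = 0"
proof -
  have "der 0 = 0" by (simp add: der_def fun_eq_iff)
  then show ?thesis using der_inject[of w 0] by simp
qed

lemma HH1_ex1:
  fixes u :: "'g \<Rightarrow>\<^sub>0 'k"
  shows "\<exists>!d. d \<in> HH1 \<and> d (gel x) = u"
proof (rule ex1I[of _ "der (gel (- x) * u)"])
  show "der (gel (- x) * u) \<in> HH1 \<and> der (gel (- x) * u) (gel x) = u"
    by (simp add: der_HH1 der_x)
qed (use HH1_eq_der in auto)

text \<open>The Euler derivation is an eigenvector for every automorphism, so invariance of \<open>w \<theta>\<close> becomes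
  an eigenvalue equation for \<open>w\<close>.\<close>

lemma der_commutes_act_iff:
  assumes y: "\<And>g h. y (g + h) = y g + y h" "y x = gx r"
  shows "(\<forall>a. der w (act y a) = act y (der w a)) \<longleftrightarrow> act y w = kscale (of_int r) w"
proof -
  have l: "der w (act y a) = kscale (of_int r) w * act y (euler a)" for a
    by (simp add: der_def euler_act[of y, OF y] kscale_mult_left kscale_mult_right)
  have r: "act y (der w a) = act y w * act y (euler a)" for a
    by (simp add: der_def act_mult[of y, OF y(1)])
  show ?thesis
  proof
    assume "\<forall>a. der w (act y a) = act y (der w a)"
    then have "kscale (of_int r) w * act y (euler (gel x)) = act y w * act y (euler (gel x))"
      by (simp only: flip: l r)
    then have "kscale (of_int r) w * gel (y x) * gel (- y x) = act y w * gel (y x) * gel (- y x)"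
      by (simp add: euler_gel act_kscale)
    then show "act y w = kscale (of_int r) w" by (simp add: mult.assoc)
  qed (simp add: l r)
qed

end

section \<open>Automorphisms and invariant derivations\<close>

lemma aut_add:
  assumes "y \<in> carrier (AutoGroup (grp :: 'g::ab_group_add monoid))"
  shows "y (g + h) = y g + y h"
  using assms by (auto simp: AutoGroup_def auto_def hom_def)

lemma aut_bij:
  assumes "y \<in> carrier (AutoGroup (grp :: 'g::ab_group_add monoid))"
  shows "bij y"
  using assms by (auto simp: AutoGroup_def auto_def Bij_def)

lemma aut_one: "\<one>\<^bsub>AutoGroup (grp :: 'g::ab_group_add monoid)\<^esub> = id"
  by (auto simp: AutoGroup_def BijGroup_def)

lemma aut_mult:
  assumes "y \<in> carrier (AutoGroup grp)" "y' \<in> carrier (AutoGroup (grp :: 'g::ab_group_add monoid))"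
  shows "y \<otimes>\<^bsub>AutoGroup grp\<^esub> y' = y \<circ> y'"
  using assms by (auto simp: AutoGroup_def auto_def BijGroup_def compose_def)

lemma group_aut: "Group.group (AutoGroup (grp :: 'g::ab_group_add monoid))"
  by (rule group.AutoGroup[OF group_grp])

lemma aut_pow:
  assumes y: "y \<in> carrier (AutoGroup (grp :: 'g::ab_group_add monoid))"
  shows "y [^]\<^bsub>AutoGroup grp\<^esub> (n :: nat) = y ^^ n"
proof (induction n)
  case 0
  show ?case by (simp add: aut_one)
next
  case (Suc n)
  have "y [^]\<^bsub>AutoGroup grp\<^esub> Suc n = y [^]\<^bsub>AutoGroup grp\<^esub> n \<otimes>\<^bsub>AutoGroup grp\<^esub> y"
    by (rule nat_pow_Suc)
  also have "\<dots> = y ^^ Suc n"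
    using aut_mult[OF monoid.nat_pow_closed[OF group.is_monoid[OF group_aut] y] y, of n]
    unfolding Suc by (simp add: funpow_Suc_right del: funpow.simps)
  finally show ?case .
qed

text \<open>Commuting with the action is visibly preserved by sums, brackets and iterates of
  derivations.\<close>

lemma act_der_fixed_iff:
  assumes y: "y \<in> carrier (AutoGroup (grp :: 'g::ab_group_add monoid))"
  shows "act_der y d = d \<longleftrightarrow> (\<forall>a. d (act y a) = act y (d a))"
proof -
  let ?y' = "inv\<^bsub>AutoGroup grp\<^esub> y"
  have y': "?y' \<in> carrier (AutoGroup grp)"
    by (rule group.inv_closed[OF group_aut y])
  have 1: "?y' \<circ> y = id" and 2: "y \<circ> ?y' = id"
    using group.l_inv[OF group_aut y] group.r_inv[OF group_aut y]
    by (simp_all add: aut_mult y y' aut_one)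
  show ?thesis
  proof
    assume fixed: "act_der y d = d"
    show "\<forall>a. d (act y a) = act y (d a)"
    proof
      fix a
      have "d (act y a) = act y (d (act ?y' (act y a)))"
        using fixed by (metis act_der_def)
      then show "d (act y a) = act y (d a)" by (simp add: act_act 1)
    qed
  next
    assume "\<forall>a. d (act y a) = act y (d a)"
    then have "act_der y d a = d (act y (act ?y' a))" for a
      by (simp add: act_der_def)
    then show "act_der y d = d" by (simp add: act_act 2 fun_eq_iff)
  qed
qed

text \<open>Raising to the \<open>p\<close>-th power improves a congruence \<open>b \<equiv> 1\<close> by one factor \<open>p\<close>, since the
  cofactor \<open>\<Sum>\<^sub>j b\<^sup>j\<close> of \<open>b - 1\<close> in \<open>b\<^sup>p - 1\<close> is \<open>\<equiv> p\<close>.  In other words, reduction modulo \<open>p\<close> of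
  the units modulo \<open>p\<^sup>n\<^sup>+\<^sup>1\<close> has a \<open>p\<close>-group as its kernel.\<close>

lemma cong_1_prime_power:
  fixes a :: int
  assumes "[a = 1] (mod int p)"
  shows "[a ^ (p ^ n) = 1] (mod int p ^ Suc n)"
proof (induction n)
  case 0
  then show ?case using assms by simp
next
  case (Suc n)
  define b where "b = a ^ (p ^ n)"
  have "[b = 1 ^ (p ^ n)] (mod int p)"
    unfolding b_def by (rule cong_pow[OF assms])
  then have "[(\<Sum>j<p. b ^ j) = (\<Sum>j<p. 1 ^ j)] (mod int p)"
    by (intro cong_sum cong_pow) simp
  then have "int p dvd (\<Sum>j<p. b ^ j)"
    by (simp add: cong_dvd_iff)
  moreover have "int p ^ Suc n dvd b - 1"
    using Suc by (simp add: b_def cong_iff_dvd_diff)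
  ultimately have "int p ^ Suc n * int p dvd (b - 1) * (\<Sum>j<p. b ^ j)"
    by (intro mult_dvd_mono)
  also have "(b - 1) * (\<Sum>j<p. b ^ j) = b ^ p - 1"
    by (simp add: power_diff_1_eq)
  also have "b ^ p = a ^ (p ^ Suc n)"
    by (simp add: b_def mult.commute flip: power_mult)
  finally show ?case by (simp add: cong_iff_dvd_diff mult.commute)
qed

locale cyclic_p'_action = cyclic_p_group_algebra p t q x field_type
  for p t q :: nat and x :: "'g::ab_group_add" and field_type :: "'k::field itself" +
  fixes e :: nat and s :: int and E :: "('g \<Rightarrow> 'g) set" and z :: "'g \<Rightarrow> 'g"
  assumes E_subgroup: "subgroup E (AutoGroup grp)" and e_def: "e = card E"
    and p'_order: "\<not> p dvd e"
    and z_E: "z \<in> E" and z_generates: "generate (AutoGroup grp) {z} = E"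
    and z_x: "z x = x [^]\<^bsub>grp\<^esub> s"
begin

lemma z_aut: "z \<in> carrier (AutoGroup grp)"
  using subgroup.subset[OF E_subgroup] z_E by blast

lemmas z_add = aut_add[OF z_aut]

lemma e_pos: "e > 0"
  using p'_order by (cases e) auto

lemma z_pow_eq_id_iff: "z ^^ i = id \<longleftrightarrow> e dvd i"
  using group.pow_eq_id[OF group_aut z_aut, of i] group.generate_pow_card[OF group_aut z_aut]
  by (simp add: aut_pow[OF z_aut] aut_one z_generates e_def)

lemma E_eq: "E = {z ^^ i |i. True}"
proof -
  have "group.ord (AutoGroup grp) z \<noteq> 0"
    using group.generate_pow_card[OF group_aut z_aut] e_pos by (simp add: z_generates e_def)
  then show ?thesis
    using group.generate_pow_nat[OF group_aut z_aut] by (simp add: z_generates aut_pow[OF z_aut])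
qed

lemma z_gx: "z (gx n) = gx (s * n)"
  by (rule additive_map_gx) (simp_all add: z_add z_x gx_def)

lemma z_pow_gx: "(z ^^ i) (gx n) = gx (s ^ i * n)"
  by (induction i) (simp_all add: z_gx mult.assoc)

lemma z_pow_add: "(z ^^ i) (g + h) = (z ^^ i) g + (z ^^ i) h"
  by (induction i) (simp_all add: z_add)

lemma s_pow_cong_q: "[s ^ i = 1] (mod int q) \<longleftrightarrow> e dvd i"
proof
  assume "[s ^ i = 1] (mod int q)"
  then have "[s ^ i * n = 1 * n] (mod int q)" for n
    by (rule cong_mult) simp
  then have "(z ^^ i) (gx n) = gx n" for n
    unfolding z_pow_gx gx_eq_iff by simp
  then have "z ^^ i = id" using gx_surj by (metis eq_id_iff)
  then show "e dvd i" by (simp add: z_pow_eq_id_iff)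
next
  assume "e dvd i"
  then have "(z ^^ i) (gx 1) = gx 1"
    unfolding z_pow_eq_id_iff [symmetric] by simp
  then show "[s ^ i = 1] (mod int q)"
    unfolding z_pow_gx gx_eq_iff by simp
qed

text \<open>Reduction modulo \<open>p\<close> does not lower the order of \<open>s\<close>: if \<open>s\<^sup>i \<equiv> 1\<close> modulo \<open>p\<close>, then
  \<open>z\<^sup>i\<close> has \<open>p\<close>-power order, and the order \<open>e\<close> of \<open>z\<close> is prime to \<open>p\<close>.\<close>

lemma s_pow_cong_p: "[s ^ i = 1] (mod int p) \<longleftrightarrow> e dvd i"
proof
  assume "[s ^ i = 1] (mod int p)"
  from cong_1_prime_power[OF this, of "t - 1"] have "[s ^ (i * p ^ (t - 1)) = 1] (mod int q)"
    using t_pos by (simp add: q_def flip: power_mult power_Suc)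
  then have "e dvd i * p ^ (t - 1)" by (simp add: s_pow_cong_q)
  moreover have "coprime e (p ^ (t - 1))"
    using prime_imp_coprime[OF prime_p p'_order] by (simp add: coprime_commute)
  ultimately show "e dvd i" by (simp add: coprime_dvd_mult_left_iff)
next
  assume "e dvd i"
  then show "[s ^ i = 1] (mod int p)"
    using p_dvd_q cong_dvd_modulus s_pow_cong_q by (metis int_dvd_int_iff)
qed

definition \<sigma> :: 'k where "\<sigma> = of_int s"

lemma \<sigma>_pow_eq_1: "\<sigma> ^ i = 1 \<longleftrightarrow> e dvd i"
  using of_int_cong_p[of "s ^ i" 1] by (simp add: \<sigma>_def s_pow_cong_p)

lemma \<sigma>_nonzero: "\<sigma> \<noteq> 0"
  using \<sigma>_pow_eq_1[of e] e_pos by (auto simp: power_0_left)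

lemma \<sigma>_sum: "(\<Sum>i<e. \<sigma> ^ i) = (if e = 1 then 1 else 0)"
proof (cases "e = 1")
  case False
  then have "\<sigma> \<noteq> 1" using \<sigma>_pow_eq_1[of 1] by auto
  moreover have "(\<sigma> - 1) * (\<Sum>i<e. \<sigma> ^ i) = 0"
    using \<sigma>_pow_eq_1[of e] by (simp flip: power_diff_1_eq)
  ultimately show ?thesis using False by simp
qed simp

lemma s_coprime: "coprime s (int q)"
proof -
  have "[s * s ^ (e - 1) = 1] (mod int q)"
    using s_pow_cong_q[of e] e_pos by (simp flip: power_Suc)
  then show ?thesis unfolding coprime_iff_invertible_int by blast
qed

text \<open>A nontrivial power of \<open>z\<close> has no fixed point besides the identity: \<open>s ^ i - 1\<close> is prime to
  \<open>p\<close>, hence invertible modulo \<open>q\<close>.\<close>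

lemma z_pow_fixed_point:
  assumes "(z ^^ i) g = g" and "\<not> e dvd i"
  shows "g = 0"
proof -
  obtain n where n: "g = gx n" using gx_surj by blast
  have "int q dvd (s ^ i - 1) * n"
    using assms(1) unfolding n z_pow_gx gx_eq_iff by (simp add: cong_iff_dvd_diff left_diff_distrib)
  moreover have "coprime (int q) (s ^ i - 1)"
  proof -
    have "\<not> int p dvd s ^ i - 1"
      using assms(2) s_pow_cong_p[of i] by (simp add: cong_iff_dvd_diff)
    then show ?thesis
      using prime_p by (simp add: q_def prime_imp_coprime)
  qed
  ultimately have "int q dvd n" by (simp add: coprime_dvd_mult_right_iff)
  then have "gx n = gx 0" unfolding gx_eq_iff by (simp add: cong_0_iff)
  then show ?thesis by (simp add: n)
qed

definition zi :: "'g \<Rightarrow> 'g" where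
  "zi = inv_into UNIV z"

lemma z_zi [simp]: "z (zi g) = g" and zi_z [simp]: "zi (z g) = g"
  using aut_bij[OF z_aut] unfolding zi_def
  by (simp_all add: bij_is_surj surj_f_inv_f bij_is_inj inv_f_f)

lemma z_pow_zi_pow [simp]: "(z ^^ i) ((zi ^^ i) g) = g"
  by (induction i arbitrary: g) (simp_all add: funpow_swap1[of z])

lemma zi_pow_z_pow [simp]: "(zi ^^ i) ((z ^^ i) g) = g"
  by (induction i arbitrary: g) (simp_all add: funpow_swap1[of zi])

lemma zi_pow_eq: "(zi ^^ i) a = b \<longleftrightarrow> (z ^^ i) b = a"
  by auto

lemma z_pow_0 [simp]: "(z ^^ i) 0 = 0"
  by (rule additive_zero) (rule z_pow_add)

lemma zi_pow_0 [simp]: "(zi ^^ i) 0 = 0"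
  by (simp add: zi_pow_eq)

lemma zi_pow_e [simp]: "(zi ^^ e) a = a"
  using z_pow_eq_id_iff[of e] by (simp add: zi_pow_eq)

lemma zi_pow_mod: "(zi ^^ (i mod e)) a = (zi ^^ i) a"
  by (rule funpow_mod_eq) simp

lemma zi_pow_gx: "(zi ^^ i) (gx n) = gx (modular_inverse (int q) s ^ i * n)"
proof -
  have "[(s * modular_inverse (int q) s) ^ i * n = 1 ^ i * n] (mod int q)"
    by (intro cong_mult cong_pow cong_modular_inverse1 s_coprime cong_refl)
  then show ?thesis
    unfolding zi_pow_eq z_pow_gx gx_eq_iff by (simp add: power_mult_distrib mult.assoc)
qed

lemma zi_pow_inj:
  assumes "a \<noteq> 0" "i < e" "j < e" "(zi ^^ i) a = (zi ^^ j) a"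
  shows "i = j"
proof -
  have aux: "i \<ge> j" if ij: "i < e" "j < e" and eq: "(zi ^^ i) a = (zi ^^ j) a" for i j
  proof (rule ccontr)
    assume "\<not> i \<ge> j"
    then obtain k where k: "j = i + k" "k > 0" by (metis less_imp_add_positive not_le)
    have "(z ^^ i) ((zi ^^ i) a) = (z ^^ i) ((zi ^^ i) ((zi ^^ k) a))"
      using eq by (simp add: k funpow_add)
    then have "(zi ^^ k) a = a" by simp
    then have "(z ^^ k) a = a" by (simp add: zi_pow_eq)
    then have "e dvd k" using z_pow_fixed_point assms(1) by blast
    then show False using k ij by (auto dest: dvd_imp_le)
  qed
  show ?thesis using aux[OF assms(2,3,4)] aux[OF assms(3,2) assms(4)[symmetric]] by simp
qed

text \<open>Invariance under all of \<open>E\<close> follows from the equation for the generator \<open>z\<close>, because iterating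
  \<open>z(w) = \<sigma> w\<close> gives \<open>z\<^sup>i(w) = \<sigma>\<^sup>i w\<close>, which is the equation for \<open>z\<^sup>i\<close>.\<close>

lemma HH1_fixed_eq: "HH1_fixed E = {der w |w. act z w = kscale \<sigma> w}"
proof -
  have pow_aut: "z ^^ i \<in> carrier (AutoGroup grp)" for i
    using subgroup.subset[OF E_subgroup] E_eq by blast
  have pow: "act (z ^^ i) w = kscale (\<sigma> ^ i) w" if "act z w = kscale \<sigma> w" for w :: "'g \<Rightarrow>\<^sub>0 'k" and i
  proof (induction i)
    case 0
    show ?case by (simp only: funpow.simps act_id power_0 kscale_one)
  next
    case (Suc i)
    have "act (z ^^ Suc i) w = act z (act (z ^^ i) w)"
      by (simp only: funpow.simps act_act)
    also have "\<dots> = kscale (\<sigma> ^ Suc i) w"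
      unfolding Suc by (simp add: act_kscale that mult.commute)
    finally show ?case .
  qed
  have fixed: "act_der (z ^^ i) (der w) = der w \<longleftrightarrow> act (z ^^ i) w = kscale (\<sigma> ^ i) w" for w i
  proof -
    have "(z ^^ i) x = gx (s ^ i)"
      using z_pow_gx[of i 1] by simp
    then show ?thesis
      using der_commutes_act_iff[of "z ^^ i", OF z_pow_add]
      by (simp add: act_der_fixed_iff[OF pow_aut] \<sigma>_def)
  qed
  have invariant: "(\<forall>y\<in>E. act_der y (der w) = der w) \<longleftrightarrow> act z w = kscale \<sigma> w" for w
  proof
    assume "\<forall>y\<in>E. act_der y (der w) = der w"
    then have "act_der (z ^^ 1) (der w) = der w" unfolding E_eq by blast
    then have "act (z ^^ 1) w = kscale (\<sigma> ^ 1) w" by (simp only: fixed)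
    moreover have "z ^^ 1 = z" by (simp add: fun_eq_iff)
    ultimately show "act z w = kscale \<sigma> w" by (simp only: power_one_right)
  next
    assume "act z w = kscale \<sigma> w"
    from pow[OF this] show "\<forall>y\<in>E. act_der y (der w) = der w"
      unfolding E_eq by (auto simp: fixed)
  qed
  show ?thesis
  proof (intro equalityI subsetI)
    fix d :: "('g \<Rightarrow>\<^sub>0 'k) \<Rightarrow> 'g \<Rightarrow>\<^sub>0 'k"
    assume d: "d \<in> HH1_fixed E"
    then obtain w where w: "d = der w"
      using HH1_eq_der by (auto simp: HH1_fixed_def)
    then have "act z w = kscale \<sigma> w"
      using d invariant[of w] by (simp add: HH1_fixed_def)
    then show "d \<in> {der w |w. act z w = kscale \<sigma> w}" using w by blast
  next
    fix d :: "('g \<Rightarrow>\<^sub>0 'k) \<Rightarrow> 'g \<Rightarrow>\<^sub>0 'k"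
    assume "d \<in> {der w |w. act z w = kscale \<sigma> w}"
    then obtain w where "d = der w" "act z w = kscale \<sigma> w" by blast
    then show "d \<in> HH1_fixed E"
      using invariant[of w] der_HH1[of w] by (simp add: HH1_fixed_def)
  qed
qed

section \<open>Orbit sums\<close>

text \<open>These are the quotients \<open>D\<^sub>m(x) / x\<close>, indexed by \<open>a = x\<^sup>m\<^sup>-\<^sup>1\<close>: dividing by \<open>x\<close> turns the
  powers of exponent \<open>(m - 1) s\<^sup>-\<^sup>i + 1\<close> into the orbit of \<open>a\<close> under \<open>z\<^sup>-\<^sup>1\<close>.\<close>

definition orbit_sum :: "'g \<Rightarrow> 'g \<Rightarrow>\<^sub>0 'k" where
  "orbit_sum a = (\<Sum>i<e. kscale (\<sigma> ^ i) (gel ((zi ^^ i) a)))"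

lemma lookup_orbit_sum:
  "Poly_Mapping.lookup (orbit_sum a) b = (\<Sum>i<e. if (zi ^^ i) a = b then \<sigma> ^ i else 0)"
  by (simp add: orbit_sum_def kscale_gel lookup_sum lookup_single when_def)

text \<open>The orbit of \<open>a \<noteq> 0\<close> is free, so only one summand contributes to this coefficient.\<close>

lemma lookup_orbit_sum_orbit:
  assumes "a \<noteq> 0" "i < e"
  shows "Poly_Mapping.lookup (orbit_sum a) ((zi ^^ i) a) = \<sigma> ^ i"
proof -
  have "Poly_Mapping.lookup (orbit_sum a) ((zi ^^ i) a) = (\<Sum>j<e. if j = i then \<sigma> ^ j else 0)"
    unfolding lookup_orbit_sum
    by (rule sum.cong) (use zi_pow_inj[OF assms(1) _ assms(2)] in auto)
  then show ?thesis using assms(2) by simp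
qed

lemma lookup_orbit_sum_outside:
  assumes "\<And>i. i < e \<Longrightarrow> (zi ^^ i) a \<noteq> b"
  shows "Poly_Mapping.lookup (orbit_sum a) b = 0"
  unfolding lookup_orbit_sum by (rule sum.neutral) (use assms in auto)

lemma orbit_sum_zero: "orbit_sum 0 = (if e = 1 then 1 else 0)"
proof -
  have "orbit_sum 0 = kscale (\<Sum>i<e. \<sigma> ^ i) 1"
    by (simp add: orbit_sum_def kP.scale_sum_left)
  then show ?thesis by (simp only: \<sigma>_sum) simp
qed

lemma orbit_sum_eq_0_iff: "orbit_sum a = 0 \<longleftrightarrow> a = 0 \<and> e \<noteq> 1"
proof (cases "a = 0")
  case False
  then have "Poly_Mapping.lookup (orbit_sum a) a = 1"
    using lookup_orbit_sum_orbit[of a 0] e_pos by simp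
  then show ?thesis using False by auto
qed (simp add: orbit_sum_zero)

lemma augmentation_orbit_sum: "augmentation (orbit_sum a) = (if e = 1 then 1 else 0)"
  by (simp only: orbit_sum_def augmentation_sum augmentation_kscale augmentation_gel mult_1_right \<sigma>_sum)

text \<open>Passing from \<open>a\<close> to the next element of its orbit shifts the index of the sum, which is cyclic
  of period \<open>e\<close>.  Equivalent labels thus give proportional derivations.\<close>

lemma orbit_sum_zi: "kscale \<sigma> (orbit_sum (zi a)) = orbit_sum a"
proof -
  define f where "f i = kscale (\<sigma> ^ i) (gel ((zi ^^ i) a))" for i
  have "kscale \<sigma> (orbit_sum (zi a)) = (\<Sum>i<e. f (Suc i))"
    by (simp add: orbit_sum_def f_def kscale_sum funpow_swap1)
  moreover have "f e = f 0"
    using \<sigma>_pow_eq_1[of e] by (simp add: f_def)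
  ultimately show ?thesis
    using sum.lessThan_Suc_shift[of f e] by (simp add: orbit_sum_def f_def)
qed

lemma orbit_sum_zi_pow: "kscale (\<sigma> ^ i) (orbit_sum ((zi ^^ i) a)) = orbit_sum a"
proof (induction i)
  case (Suc i)
  have "kscale (\<sigma> ^ Suc i) (orbit_sum ((zi ^^ Suc i) a))
      = kscale (\<sigma> ^ i) (kscale \<sigma> (orbit_sum (zi ((zi ^^ i) a))))"
    by (simp add: mult.commute)
  then show ?case unfolding orbit_sum_zi Suc .
qed simp

lemma act_orbit_sum: "act z (orbit_sum a) = kscale \<sigma> (orbit_sum a)"
proof -
  have "z ((zi ^^ i) a) = (zi ^^ i) (z a)" for i
    by (induction i) (simp, metis funpow.simps(2) o_apply z_zi zi_z)
  then have "act z (orbit_sum a) = orbit_sum (z a)"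
    by (simp add: orbit_sum_def act_sum act_kscale)
  then show ?thesis using orbit_sum_zi[of "z a"] by simp
qed

text \<open>The operator \<open>\<sigma> z\<^sup>-\<^sup>1\<close> fixes \<open>w\<close>, so \<open>w\<close> is the average of its images under the \<open>e\<close> powers of
  that operator; applied to a single group element \<open>g\<close>, these powers add up to the orbit sum of \<open>g\<close>.\<close>

lemma average_orbit_sums:
  assumes w: "act z w = kscale \<sigma> w"
  shows "kscale (of_nat e) w = (\<Sum>g\<in>UNIV. kscale (Poly_Mapping.lookup w g) (orbit_sum g))"
proof -
  have zi_id: "zi \<circ> z = id" by (simp add: fun_eq_iff)
  have "kscale \<sigma> (act zi w) = act zi (act z w)"
    by (simp only: w act_kscale)
  also have "\<dots> = w"
    by (simp only: act_act zi_id act_id)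
  finally have step: "kscale \<sigma> (act zi w) = w" .
  have pow: "kscale (\<sigma> ^ i) (act (zi ^^ i) w) = w" for i
  proof (induction i)
    case 0
    show ?case by (simp only: funpow.simps act_id power_0 kscale_one)
  next
    case (Suc i)
    have "kscale (\<sigma> ^ Suc i) (act (zi ^^ Suc i) w) = kscale \<sigma> (act zi (kscale (\<sigma> ^ i) (act (zi ^^ i) w)))"
      by (simp only: funpow.simps act_act act_kscale kscale_kscale power_Suc)
    then show ?case unfolding Suc step .
  qed
  have "kscale (of_nat e) w = (\<Sum>i<e. w)"
    by (simp flip: of_nat_times_conv)
  also have "\<dots> = (\<Sum>i<e. kscale (\<sigma> ^ i) (act (zi ^^ i) w))"
    by (simp only: pow)
  also have "\<dots> = (\<Sum>i<e. kscale (\<sigma> ^ i) (act (zi ^^ i)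
        (\<Sum>g\<in>UNIV. Poly_Mapping.single g (Poly_Mapping.lookup w g))))"
    by (simp only: sum_singles[OF finite_P])
  also have "\<dots> = (\<Sum>i<e. \<Sum>g\<in>UNIV. kscale (Poly_Mapping.lookup w g) (kscale (\<sigma> ^ i) (gel ((zi ^^ i) g))))"
    by (simp add: act_sum kscale_sum kscale_gel mult.commute)
  also have "\<dots> = (\<Sum>g\<in>UNIV. kscale (Poly_Mapping.lookup w g) (orbit_sum g))"
    by (subst sum.swap) (simp add: orbit_sum_def kscale_sum)
  finally show ?thesis .
qed

section \<open>The derivations of the theorem\<close>

definition orbit_der :: "'g \<Rightarrow> ('g \<Rightarrow>\<^sub>0 'k) \<Rightarrow> 'g \<Rightarrow>\<^sub>0 'k" where
  "orbit_der a = der (orbit_sum a)"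

lemma orbit_der_HH1: "orbit_der a \<in> HH1"
  by (simp add: orbit_der_def der_HH1)

lemma orbit_der_fixed: "orbit_der a \<in> HH1_fixed E"
  unfolding HH1_fixed_eq orbit_der_def using act_orbit_sum by blast

lemma orbit_der_eq_0_iff: "orbit_der a = 0 \<longleftrightarrow> a = 0 \<and> e \<noteq> 1"
  by (simp add: orbit_der_def der_zero orbit_sum_eq_0_iff)

text \<open>If \<open>a \<noteq> 0\<close>, the coefficient of \<open>orbit_sum a\<close> at \<open>a\<close> is \<open>1\<close>, while on the rest of the orbit
  the coefficients are powers \<open>\<sigma>\<^sup>i \<noteq> 1\<close>; so \<open>a\<close> can be read off from its orbit sum.\<close>

lemma orbit_der_inject: "orbit_der a = orbit_der b \<longleftrightarrow> a = b"
proof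
  have aux: "a = b" if eq: "orbit_sum a = orbit_sum b" and "a \<noteq> 0" for a b
  proof -
    have 1: "Poly_Mapping.lookup (orbit_sum b) a = 1"
      using lookup_orbit_sum_orbit[OF \<open>a \<noteq> 0\<close>, of 0] e_pos eq by simp
    then obtain i where i: "i < e" "(zi ^^ i) b = a"
      using lookup_orbit_sum_outside[of b a] by fastforce
    then have "b \<noteq> 0" using \<open>a \<noteq> 0\<close> by auto
    then have "\<sigma> ^ i = 1"
      using lookup_orbit_sum_orbit[OF _ i(1), of b] 1 i(2) by simp
    then have "i = 0" using i(1) \<sigma>_pow_eq_1[of i] by (auto dest: dvd_imp_le)
    then show "a = b" using i(2) by simp
  qed
  assume "orbit_der a = orbit_der b"
  then have "orbit_sum a = orbit_sum b" by (simp add: orbit_der_def der_inject)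
  then show "a = b" using aux[of a b] aux[of b a] by fastforce
qed simp

lemma gel_x_power_Dexp:
  "gel x ^ Dexp q s m i = (gel x * gel ((zi ^^ i) (gx (int m - 1))) :: 'g \<Rightarrow>\<^sub>0 'k)"
proof -
  let ?n = "(int m - 1) * modular_inverse (int q) s ^ i + 1"
  have "gx (int (Dexp q s m i)) = gx ?n"
    unfolding gx_eq_iff using q_ge_2 by (simp add: Dexp_def cong_def)
  also have "gx ?n = x + (zi ^^ i) (gx (int m - 1))"
    by (simp add: zi_pow_gx gx_add add.commute mult.commute)
  finally show ?thesis by (simp add: gel_x_power gel_add)
qed

lemma Dimage_eq: "Dimage q e s x m = gel x * orbit_sum (gx (int m - 1))"
  by (simp add: Dimage_def orbit_sum_def \<sigma>_def gel_x_power_Dexp kscale_mult_right sum_distrib_left)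

lemma D_eq: "D q e s x m = orbit_der (gx (int m - 1))"
  unfolding D_def
proof (rule the1_equality)
  show "\<exists>!d. d \<in> HH1 \<and> d (gel x) = (Dimage q e s x m :: 'g \<Rightarrow>\<^sub>0 'k)"
    by (rule HH1_ex1)
qed (simp add: orbit_der_HH1, simp add: orbit_der_def der_x Dimage_eq mult.commute)

text \<open>Reduction modulo \<open>q\<close> lets the labels \<open>m < q\<close> reach all of \<open>P\<close>, with \<open>m = 0\<close> giving \<open>- x\<close>.\<close>

lemma gx_index: "\<exists>m<q. a = gx (int m - 1)"
proof -
  obtain n where n: "a = gx n" using gx_surj by blast
  let ?m = "nat ((n + 1) mod int q)"
  have "gx (int ?m - 1) = gx n"
    unfolding gx_eq_iff using q_ge_2 by (simp add: cong_def mod_diff_left_eq)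
  moreover have "?m < q" using q_ge_2 by (simp add: nat_less_iff)
  ultimately show ?thesis using n by metis
qed

lemma D_image: "D q e s x ` {..<q} = range orbit_der"
proof
  show "range orbit_der \<subseteq> D q e s x ` {..<q}"
  proof
    fix d :: "('g \<Rightarrow>\<^sub>0 'k) \<Rightarrow> 'g \<Rightarrow>\<^sub>0 'k"
    assume "d \<in> range orbit_der"
    then obtain a where a: "d = orbit_der a" by blast
    obtain m where "m < q" "a = gx (int m - 1)" using gx_index by blast
    then show "d \<in> D q e s x ` {..<q}" by (auto simp: a D_eq)
  qed
qed (auto simp: D_eq)

lemma D_eq_0_iff:
  assumes "m < q"
  shows "D q e s x m = (0 :: ('g \<Rightarrow>\<^sub>0 'k) \<Rightarrow> 'g \<Rightarrow>\<^sub>0 'k) \<longleftrightarrow> m = 1 \<and> e \<noteq> 1"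
proof -
  have "gx (int m - 1) = gx 0 \<longleftrightarrow> int m mod int q = 1 mod int q"
    unfolding gx_eq_iff by (simp add: cong_iff_dvd_diff flip: mod_eq_dvd_iff)
  also have "\<dots> \<longleftrightarrow> m = 1"
    using assms q_ge_2 by auto
  finally show ?thesis by (simp add: D_eq orbit_der_eq_0_iff)
qed

lemma Dsim_eq:
  "Dsim q e s x = {(orbit_der a, orbit_der b) |a b. \<exists>i<e. b = (zi ^^ i) a}"
proof -
  have Dexp: "gx (int (Dexp q s m i) - 1) = (zi ^^ i) (gx (int m - 1))" for m i
  proof -
    have "[int (Dexp q s m i) - 1 = (int m - 1) * modular_inverse (int q) s ^ i + 1 - 1] (mod int q)"
      by (rule cong_diff) (use q_ge_2 in \<open>simp_all add: Dexp_def cong_def\<close>)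
    then show ?thesis
      unfolding zi_pow_gx gx_eq_iff by (simp add: mult.commute)
  qed
  have less: "Dexp q s m i < q" for m i
    using q_ge_2 by (simp add: Dexp_def nat_less_iff)
  show ?thesis
  proof (intro equalityI subrelI)
    fix d d' :: "('g \<Rightarrow>\<^sub>0 'k) \<Rightarrow> 'g \<Rightarrow>\<^sub>0 'k"
    assume "(d, d') \<in> Dsim q e s x"
    then obtain m i where "d = orbit_der (gx (int m - 1))" "i < e"
      "d' = orbit_der ((zi ^^ i) (gx (int m - 1)))"
      by (auto simp: Dsim_def D_eq Dexp)
    then show "(d, d') \<in> {(orbit_der a, orbit_der b) |a b. \<exists>i<e. b = (zi ^^ i) a}" by blast
  next
    fix d d' :: "('g \<Rightarrow>\<^sub>0 'k) \<Rightarrow> 'g \<Rightarrow>\<^sub>0 'k"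
    assume "(d, d') \<in> {(orbit_der a, orbit_der b) |a b. \<exists>i<e. b = (zi ^^ i) a}"
    then obtain a i where ai: "d = orbit_der a" "d' = orbit_der ((zi ^^ i) a)" "i < e" by blast
    obtain m where m: "m < q" "a = gx (int m - 1)" using gx_index by blast
    then have "d = D q e s x m" "d' = D q e s x (Dexp q s m i)"
      by (simp_all add: ai D_eq Dexp)
    then show "(d, d') \<in> Dsim q e s x"
      unfolding Dsim_def using m(1) less ai(3) by blast
  qed
qed

text \<open>The bound \<open>i < e\<close> can be dropped since \<open>z\<close> has order \<open>e\<close>; without it the relation is that of
  lying in the same orbit, and symmetry and transitivity become evident.\<close>

lemma Dsim_iff: "(orbit_der a, orbit_der b) \<in> Dsim q e s x \<longleftrightarrow> (\<exists>i. b = (zi ^^ i) a)"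
proof
  assume "\<exists>i. b = (zi ^^ i) a"
  then obtain i where "b = (zi ^^ (i mod e)) a" by (auto simp: zi_pow_mod)
  moreover have "i mod e < e" using e_pos by simp
  ultimately show "(orbit_der a, orbit_der b) \<in> Dsim q e s x"
    unfolding Dsim_eq by blast
qed (auto simp: Dsim_eq orbit_der_inject)

lemma Dsim_equiv: "equiv (range orbit_der) (Dsim q e s x)"
proof (rule equivI)
  let ?r = "Dsim q e s x :: ((('g \<Rightarrow>\<^sub>0 'k) \<Rightarrow> 'g \<Rightarrow>\<^sub>0 'k) \<times> (('g \<Rightarrow>\<^sub>0 'k) \<Rightarrow> 'g \<Rightarrow>\<^sub>0 'k)) set"
  show "Dsim q e s x \<subseteq> range orbit_der \<times> range orbit_der"
    by (auto simp: Dsim_eq)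
  show "refl_on (range orbit_der) (Dsim q e s x)"
  proof (rule refl_onI)
    fix d :: "('g \<Rightarrow>\<^sub>0 'k) \<Rightarrow> 'g \<Rightarrow>\<^sub>0 'k"
    assume "d \<in> range orbit_der"
    then obtain a where "d = orbit_der a" by blast
    moreover have "(orbit_der a, orbit_der a) \<in> Dsim q e s x"
      unfolding Dsim_iff by (rule exI[of _ 0]) simp
    ultimately show "(d, d) \<in> Dsim q e s x" by simp
  qed
  show "sym ?r"
  proof (rule symI)
    fix d d' :: "('g \<Rightarrow>\<^sub>0 'k) \<Rightarrow> 'g \<Rightarrow>\<^sub>0 'k"
    assume "(d, d') \<in> Dsim q e s x"
    then obtain a i where ai: "d = orbit_der a" "d' = orbit_der ((zi ^^ i) a)" "i < e"
      by (auto simp: Dsim_eq)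
    have "(zi ^^ (e - i)) ((zi ^^ i) a) = (zi ^^ (e - i + i)) a"
      by (simp only: funpow_add o_apply)
    then have "a = (zi ^^ (e - i)) ((zi ^^ i) a)" using ai(3) by simp
    then show "(d', d) \<in> Dsim q e s x"
      unfolding ai Dsim_iff by blast
  qed
  show "trans ?r"
  proof (rule transI)
    fix d d' d'' :: "('g \<Rightarrow>\<^sub>0 'k) \<Rightarrow> 'g \<Rightarrow>\<^sub>0 'k"
    assume 1: "(d, d') \<in> Dsim q e s x" and 2: "(d', d'') \<in> Dsim q e s x"
    obtain a b where ab: "d = orbit_der a" "d' = orbit_der b" using 1 by (auto simp: Dsim_eq)
    obtain c where c: "d'' = orbit_der c" using 2 by (auto simp: Dsim_eq)
    obtain i j where "b = (zi ^^ i) a" "c = (zi ^^ j) b"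
      using 1 2 unfolding ab c Dsim_iff by blast
    then have "c = (zi ^^ (j + i)) a" by (simp add: funpow_add)
    then show "(d, d'') \<in> Dsim q e s x" unfolding ab c Dsim_iff by blast
  qed
qed

section \<open>The invariant derivations\<close>

abbreviation invariants :: "(('g \<Rightarrow>\<^sub>0 'k) \<Rightarrow> 'g \<Rightarrow>\<^sub>0 'k) set" where
  "invariants \<equiv> HH1_fixed E"

lemma der_invariant: "act z w = kscale \<sigma> w \<Longrightarrow> der w \<in> invariants"
  by (auto simp: HH1_fixed_eq)

lemma invariantE:
  assumes "d \<in> invariants"
  obtains w where "d = der w" "act z w = kscale \<sigma> w"
  using assms by (auto simp: HH1_fixed_eq)

lemma der_add: "der (v + w) = der v + der w"
  by (simp add: der_def distrib_right fun_eq_iff)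

lemma der_kscale: "der (kscale c w) = endo_scale c (der w)"
  by (simp add: der_def endo_scale_def kscale_mult_left)

lemma HH1_fixed_commutes_iff:
  "d \<in> invariants \<longleftrightarrow> d \<in> HH1 \<and> (\<forall>y\<in>E. \<forall>a. d (act y a) = act y (d a))"
  using act_der_fixed_iff subgroup.subset[OF E_subgroup] by (auto simp: HH1_fixed_def subset_iff)

lemma HH1_fixed_subspace: "kEnd.subspace invariants"
proof (rule kEnd.subspaceI)
  have "act z (0 :: 'g \<Rightarrow>\<^sub>0 'k) = 0"
    by (rule additive_zero) (rule act_add)
  then have "der 0 \<in> invariants" by (intro der_invariant) simp
  then show "0 \<in> invariants" using der_zero[of 0] by simp
next
  fix d d' assume "d \<in> invariants" "d' \<in> invariants"
  then obtain w w' where "d = der w" "d' = der w'"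
    and "act z w = kscale \<sigma> w" "act z w' = kscale \<sigma> w'"
    by (elim invariantE)
  then show "d + d' \<in> invariants"
    using der_invariant[of "w + w'"] by (simp add: der_add act_add kscale_add)
next
  fix c d assume "d \<in> invariants"
  then obtain w where "d = der w" "act z w = kscale \<sigma> w"
    by (elim invariantE)
  then show "endo_scale c d \<in> invariants"
    using der_invariant[of "kscale c w"] by (simp add: der_kscale act_kscale mult.commute)
qed

lemma HH1_fixed_lie_subalgebra: "lie_subalgebra (invariants)"
  unfolding lie_subalgebra_def
proof (intro conjI ballI HH1_fixed_subspace)
  show "invariants \<subseteq> HH1" by (auto simp: HH1_fixed_def)
  fix d d' assume d: "d \<in> invariants" and d': "d' \<in> invariants"
  have act_diff: "act y (a - b) = act y a - act y b" for y and a b :: "'g \<Rightarrow>\<^sub>0 'k"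
    using act_add[of y "a - b" b] by (simp add: algebra_simps)
  have "lie_bracket d d' \<in> HH1"
    using d d' by (intro HH1_lie_bracket) (simp_all add: HH1_fixed_commutes_iff)
  moreover have "lie_bracket d d' (act y a) = act y (lie_bracket d d' a)" if "y \<in> E" for y a
    using d d' that by (simp add: lie_bracket_def act_diff HH1_fixed_commutes_iff)
  ultimately show "lie_bracket d d' \<in> invariants"
    by (simp add: HH1_fixed_commutes_iff)
qed

lemma span_orbit_ders: "kEnd.span (range orbit_der) = invariants"
proof
  show "kEnd.span (range orbit_der) \<subseteq> invariants"
    by (rule kEnd.span_minimal[OF _ HH1_fixed_subspace]) (use orbit_der_fixed in blast)
  show "invariants \<subseteq> kEnd.span (range orbit_der)"
  proof
    fix d assume "d \<in> invariants"
    then obtain w where d: "d = der w" and w: "act z w = kscale \<sigma> w"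
      by (elim invariantE)
    have e0: "of_nat e \<noteq> (0 :: 'k)"
      using p'_order by (simp add: of_nat_eq_0_iff_char_dvd char_k)
    have "w = kscale (inverse (of_nat e)) (kscale (of_nat e) w)"
      using e0 by simp
    also have "\<dots> = kscale (inverse (of_nat e))
        (\<Sum>g\<in>UNIV. kscale (Poly_Mapping.lookup w g) (orbit_sum g))"
      by (simp only: average_orbit_sums[OF w])
    finally have "d = der (kscale (inverse (of_nat e))
        (\<Sum>g\<in>UNIV. kscale (Poly_Mapping.lookup w g) (orbit_sum g)))"
      by (simp only: d)
    also have "\<dots> = endo_scale (inverse (of_nat e))
        (\<Sum>g\<in>UNIV. endo_scale (Poly_Mapping.lookup w g) (orbit_der g))"
      by (simp only: der_kscale additive_sum[of der, OF der_add] orbit_der_def)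
    also have "\<dots> \<in> kEnd.span (range orbit_der)"
      by (intro kEnd.span_scale kEnd.span_sum kEnd.span_base rangeI)
    finally show "d \<in> kEnd.span (range orbit_der)" .
  qed
qed

lemma orbit_der_zi_pow: "endo_scale (\<sigma> ^ i) (orbit_der ((zi ^^ i) a)) = orbit_der a"
  by (simp only: orbit_der_def orbit_sum_zi_pow flip: der_kscale)

text \<open>The left-hand side is a linear functional of the derivation.  For representatives \<open>b\<close> of the
  orbits with nonzero derivation these functionals are dual to the derivations, whence
  independence.\<close>

lemma orbit_der_coefficient:
  "Poly_Mapping.lookup (orbit_der a (gel x)) (b + x) = Poly_Mapping.lookup (orbit_sum a) b"
  by (simp add: orbit_der_def der_x mult.commute[of _ "gel x"])
    (simp add: gel_def lookup_single_times)

lemma representatives_basis: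
  assumes R: "class_representatives (range orbit_der) (Dsim q e s x) R"
  shows "is_basis (R - {0}) (invariants)"
proof -
  have sub: "R \<subseteq> range orbit_der"
    using R by (simp add: class_representatives_def)
  have unique: "\<exists>!d. d \<in> R \<inter> Dsim q e s x `` {orbit_der a}" for a
  proof -
    have "Dsim q e s x `` {orbit_der a} \<in> range orbit_der // Dsim q e s x"
      by (rule quotientI) simp
    with conjunct2[OF R[unfolded class_representatives_def]] show ?thesis
      by (rule bspec)
  qed
  have rep: "\<exists>i. orbit_der ((zi ^^ i) a) \<in> R" for a
  proof -
    obtain d where d: "d \<in> R" "(orbit_der a, d) \<in> Dsim q e s x"
      using unique[of a] by blast
    then obtain b where b: "d = orbit_der b" using sub by blast
    then obtain i where "b = (zi ^^ i) a" using d Dsim_iff by auto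
    then show ?thesis using b d by auto
  qed
  have same: "(zi ^^ i) a = a" if "orbit_der a \<in> R" "orbit_der ((zi ^^ i) a) \<in> R" for a i
  proof -
    have "a = (zi ^^ 0) a" by simp
    then have "(orbit_der a, orbit_der a) \<in> Dsim q e s x"
      "(orbit_der a, orbit_der ((zi ^^ i) a)) \<in> Dsim q e s x"
      unfolding Dsim_iff by blast+
    then have "orbit_der a = orbit_der ((zi ^^ i) a)"
      using unique[of a] that by blast
    then show ?thesis by (simp add: orbit_der_inject)
  qed
  have "R - {0} \<subseteq> invariants"
    using sub orbit_der_fixed by blast
  moreover have "kEnd.independent (R - {0})"
    unfolding kEnd.independent_explicit_module
  proof (intro allI impI)
    fix T u v
    assume T: "finite T" "T \<subseteq> R - {0}" and sum0: "(\<Sum>v\<in>T. endo_scale (u v) v) = 0" and v: "v \<in> T"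
    obtain b where b: "v = orbit_der b" using v T sub by blast
    \<comment> \<open>The functional dual to \<open>v\<close>: it is \<open>1\<close> on \<open>v\<close> and \<open>0\<close> on all other elements of \<open>T\<close>.\<close>
    define coeff where
      "coeff d = Poly_Mapping.lookup (d (gel x) :: 'g \<Rightarrow>\<^sub>0 'k) (b + x)" for d :: "('g \<Rightarrow>\<^sub>0 'k) \<Rightarrow> 'g \<Rightarrow>\<^sub>0 'k"
    have coeff_add: "coeff (d + d') = coeff d + coeff d'" for d d'
      by (simp add: coeff_def lookup_add)
    have coeff_scale: "coeff (endo_scale c d) = c * coeff d" for c d
      by (simp add: coeff_def endo_scale_def)
    have coeff_der: "coeff (orbit_der a) = Poly_Mapping.lookup (orbit_sum a) b" for a
      by (simp only: coeff_def orbit_der_coefficient)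
    have "orbit_der b \<noteq> 0" using v T b by blast
    then have nonzero: "b \<noteq> 0 \<or> e = 1" by (simp only: orbit_der_eq_0_iff) blast
    have "coeff v = 1"
    proof (cases "b = 0")
      case True
      then have "orbit_sum b = 1" using nonzero orbit_sum_zero by metis
      then show ?thesis using True by (simp add: b coeff_der)
    next
      case False
      then show ?thesis
        using lookup_orbit_sum_orbit[of b 0] e_pos by (simp add: b coeff_der)
    qed
    moreover have "coeff v' = 0" if v': "v' \<in> T" "v' \<noteq> v" for v'
    proof -
      obtain a where a: "v' = orbit_der a" using v' T sub by blast
      have "(zi ^^ i) a \<noteq> b" for i
      proof
        assume i: "(zi ^^ i) a = b"
        then have "orbit_der a \<in> R" "orbit_der ((zi ^^ i) a) \<in> R"
          using v v' T a b by auto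
        from same[OF this] show False using i v' a b by simp
      qed
      then show ?thesis
        by (simp add: a coeff_der lookup_orbit_sum_outside)
    qed
    moreover have "(\<Sum>v'\<in>T. u v' * coeff v') = 0"
    proof -
      have "(\<Sum>v'\<in>T. u v' * coeff v') = coeff (\<Sum>v'\<in>T. endo_scale (u v') v')"
        by (simp only: additive_sum[of coeff, OF coeff_add] coeff_scale)
      then show ?thesis using additive_zero[of coeff, OF coeff_add] by (simp only: sum0)
    qed
    moreover have "(\<Sum>v'\<in>T. u v' * coeff v') = u v * coeff v + (\<Sum>v'\<in>T - {v}. u v' * coeff v')"
      by (rule sum.remove[OF T(1) v])
    ultimately show "u v = 0" by simp
  qed
  moreover have "kEnd.span (R - {0}) = invariants"
  proof
    show "kEnd.span (R - {0}) \<subseteq> invariants"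
      by (rule kEnd.span_minimal[OF _ HH1_fixed_subspace]) fact
    have "range orbit_der \<subseteq> kEnd.span (R - {0})"
    proof clarify
      fix a
      obtain i where i: "orbit_der ((zi ^^ i) a) \<in> R" using rep by blast
      have "orbit_der ((zi ^^ i) a) \<in> kEnd.span (R - {0})"
        by (cases "orbit_der ((zi ^^ i) a) = 0") (use i in \<open>auto intro: kEnd.span_base kEnd.span_zero\<close>)
      then have "endo_scale (\<sigma> ^ i) (orbit_der ((zi ^^ i) a)) \<in> kEnd.span (R - {0})"
        by (rule kEnd.span_scale)
      then show "orbit_der a \<in> kEnd.span (R - {0})" by (simp only: orbit_der_zi_pow)
    qed
    then show "invariants \<subseteq> kEnd.span (R - {0})"
      unfolding span_orbit_ders [symmetric] by (rule kEnd.span_minimal) (rule kEnd.subspace_span)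
  qed
  ultimately show ?thesis by (simp add: is_basis_def)
qed

section \<open>A toral basis\<close>

text \<open>On the augmentation ideal \<open>J\<close> this functional has kernel \<open>J\<^sup>2\<close>, so it is the coordinate of
  \<open>J/J\<^sup>2\<close> in which \<open>x - 1\<close> is the unit.  It is also defined outside \<open>J\<close> and is \<open>1\<close> at \<open>x\<close>.\<close>

definition tangent :: "('g \<Rightarrow>\<^sub>0 'k) \<Rightarrow> 'k" where
  "tangent a = augmentation (euler a)"

text \<open>A derivation with values in \<open>J\<close> acts on \<open>J/J\<^sup>2\<close> by a scalar, the coordinate of \<open>w\<close>.\<close>

lemma tangent_der:
  assumes "augmentation w = 0"
  shows "tangent (der w a) = tangent w * tangent a"
  by (simp add: tangent_def der_def euler_mult augmentation_add augmentation_mult assms)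

lemma dlog_z_pow: "dlog ((z ^^ i) g) = \<sigma> ^ i * dlog g"
proof -
  obtain n where "g = gx n" using gx_surj by blast
  then show ?thesis by (simp add: z_pow_gx \<sigma>_def)
qed

lemma tangent_orbit_sum: "tangent (orbit_sum a) = of_nat e * dlog a"
proof -
  have "tangent (orbit_sum a) = (\<Sum>i<e. \<sigma> ^ i * dlog ((zi ^^ i) a))"
    unfolding tangent_def orbit_sum_def additive_sum[of euler, OF euler_add] augmentation_sum
    by (simp add: euler_kscale euler_gel)
  also have "\<dots> = (\<Sum>i<e. dlog a)"
    by (simp flip: dlog_z_pow)
  finally show ?thesis by simp
qed

lemma HH1_fixed_funpow_p:
  assumes "d \<in> invariants"
  shows "d ^^ p \<in> invariants"
proof -
  have "(d ^^ n) (act y a) = act y ((d ^^ n) a)" if "y \<in> E" for n y a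
    using assms that by (induction n) (simp_all add: HH1_fixed_commutes_iff)
  moreover have "d \<in> HH1"
    using assms by (simp add: HH1_fixed_def)
  from HH1_funpow_char[OF this prime_p char_k] have "d ^^ p \<in> HH1" .
  ultimately show ?thesis
    by (simp add: HH1_fixed_commutes_iff)
qed

text \<open>There are \<open>p - 1 = e\<close> nonzero elements in \<open>P\<close>, so they form a single free orbit and the
  invariants are one-dimensional.  The scalar \<open>c\<close> in \<open>D\<^sup>p = c D\<close> is found by comparing both sides on
  \<open>J/J\<^sup>2\<close>, where \<open>D\<close> is the identity.\<close>

lemma p_toral_basis_orbit_der:
  assumes "p > 2" "t = 1" "e = p - 1"
  shows "p_toral_basis p {orbit_der (- x)} (invariants)"
proof -
  let ?d = "orbit_der (- x)"
  have "q = p" using assms(2) by (simp add: q_def)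
  have "e \<noteq> 1" using assms by simp
  have x: "- x = gx (- 1)" by (simp add: gx_minus)
  have x0: "- x \<noteq> 0"
  proof
    assume "- x = 0"
    then have "x = 0" by simp
    then have "gx 1 = gx 0" unfolding gx_1 gx_0 .
    then show False unfolding gx_eq_iff using q_ge_2 by (simp add: cong_def)
  qed
  have orbit: "(\<lambda>i. (zi ^^ i) (- x)) ` {..<e} = UNIV - {0}"
  proof (rule card_subset_eq)
    show "finite (UNIV - {0 :: 'g})" using finite_P by simp
    show "(\<lambda>i. (zi ^^ i) (- x)) ` {..<e} \<subseteq> UNIV - {0}"
      using x0 by (auto simp: zi_pow_eq)
    have "inj_on (\<lambda>i. (zi ^^ i) (- x)) {..<e}"
      by (rule inj_onI) (use zi_pow_inj[OF x0] in auto)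
    then show "card ((\<lambda>i. (zi ^^ i) (- x)) ` {..<e}) = card (UNIV - {0 :: 'g})"
      using finite_P card_P assms(3) \<open>q = p\<close> by (simp add: card_image card_Diff_singleton)
  qed
  have span: "kEnd.span {?d} = invariants"
  proof
    show "kEnd.span {?d} \<subseteq> invariants"
      by (rule kEnd.span_minimal[OF _ HH1_fixed_subspace]) (use orbit_der_fixed in blast)
    have "range orbit_der \<subseteq> kEnd.span {?d}"
    proof clarify
      fix a
      show "orbit_der a \<in> kEnd.span {?d}"
      proof (cases "a = 0")
        case True
        then have "orbit_der a = 0" using \<open>e \<noteq> 1\<close> by (simp add: orbit_der_eq_0_iff)
        then show ?thesis by (simp only: kEnd.span_zero)
      next
        case False
        then obtain i where "a = (zi ^^ i) (- x)" using orbit by blast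
        then have "endo_scale (\<sigma> ^ i) (orbit_der a) \<in> kEnd.span {?d}"
          by (simp only: orbit_der_zi_pow) (simp add: kEnd.span_base)
        then have "endo_scale (inverse (\<sigma> ^ i)) (endo_scale (\<sigma> ^ i) (orbit_der a)) \<in> kEnd.span {?d}"
          by (rule kEnd.span_scale)
        then show ?thesis using \<sigma>_nonzero by simp
      qed
    qed
    then show "invariants \<subseteq> kEnd.span {?d}"
      unfolding span_orbit_ders [symmetric] by (rule kEnd.span_minimal) (rule kEnd.subspace_span)
  qed
  have "?d \<noteq> 0" using x0 by (simp add: orbit_der_eq_0_iff)
  then have "kEnd.independent {?d}" by simp
  have "?d ^^ p = ?d"
  proof -
    have "?d ^^ p \<in> kEnd.span {?d}"
      unfolding span by (rule HH1_fixed_funpow_p) (rule orbit_der_fixed)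
    then obtain c where c: "?d ^^ p = endo_scale c ?d"
      by (auto simp: kEnd.span_singleton)
    have "of_nat (p - 1) + 1 = (of_nat (Suc (p - 1)) :: 'k)" by simp
    also have "Suc (p - 1) = p" using p_ge_2 by simp
    also have "of_nat p = (0 :: 'k)" using of_nat_CHAR[where 'a = 'k] by (simp only: char_k)
    finally have minus_e: "- of_nat e = (1 :: 'k)"
      by (simp add: assms(3) neg_eq_iff_add_eq_0)
    have "dlog (- x) = - 1" unfolding x dlog_gx by simp
    then have "tangent (orbit_sum (- x)) = 1"
      using minus_e by (simp add: tangent_orbit_sum)
    then have tangent_d: "tangent (?d a) = tangent a" for a
      using tangent_der[of "orbit_sum (- x)"] \<open>e \<noteq> 1\<close>
      by (simp add: orbit_der_def augmentation_orbit_sum)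
    have tangent_pow: "tangent ((?d ^^ n) a) = tangent a" for n a
      by (induction n) (simp_all add: tangent_d)
    have tangent_x: "tangent (gel x) = 1"
      by (simp add: tangent_def euler_gel)
    have "1 = tangent ((?d ^^ p) (gel x))"
      by (simp only: tangent_pow tangent_x)
    also have "\<dots> = c * tangent (?d (gel x))"
      by (simp add: c endo_scale_def tangent_def euler_kscale)
    also have "\<dots> = c" by (simp only: tangent_d tangent_x mult_1_right)
    finally show ?thesis using c by simp
  qed
  then show ?thesis
    using \<open>kEnd.independent {?d}\<close> span orbit_der_fixed
    by (simp add: p_toral_basis_def is_basis_def)
qed

end

theorem theorem3p5:
  fixes p t q e :: nat
    and s :: int
    and x :: "'g::ab_group_add"
    and E :: "('g \<Rightarrow> 'g) set"
    and z :: "'g \<Rightarrow> 'g"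
    and D' :: "nat \<Rightarrow> ('g \<Rightarrow>\<^sub>0 'k::alg_closed_field) \<Rightarrow> 'g \<Rightarrow>\<^sub>0 'k"
    and V :: "(('g \<Rightarrow>\<^sub>0 'k) \<Rightarrow> 'g \<Rightarrow>\<^sub>0 'k) set"
  assumes p: "Factorial_Ring.prime p" and char: "CHAR('k) = p"
    and q: "q = p ^ t" and t: "t \<ge> 1"
    and order_P: "Coset.order (grp :: 'g monoid) = q"
    and x: "generate grp {x} = carrier grp"
    and E: "subgroup E (AutoGroup grp)" and e: "e = card E" and p': "\<not> p dvd e"
    and z: "z \<in> E" "generate (AutoGroup grp) {z} = E" "z x = x [^]\<^bsub>grp\<^esub> s"
    and D': "D' = D q e s x"
    and V: "V = HH1_fixed E"
  shows
    "(\<forall>m<q. \<exists>!d. d \<in> HH1 \<and> d (gel x) = (Dimage q e s x m :: 'g \<Rightarrow>\<^sub>0 'k))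
     \<and> equiv (D' ` {..<q}) (Dsim q e s x)
     \<comment> \<open>(i)\<close>
     \<and> (E \<noteq> {\<one>\<^bsub>AutoGroup grp\<^esub>} \<longrightarrow> (\<forall>m<q. D' m (gel x) \<in> jacobson_radical))
     \<comment> \<open>(ii): \<open>D\<^sub>1 = 0\<close> if \<open>E\<close> is nontrivial, and this is the only vanishing \<open>D\<^sub>m\<close>\<close>
     \<and> lie_subalgebra V
     \<and> (\<forall>m<q. D' m = 0 \<longleftrightarrow> m = 1 \<and> E \<noteq> {\<one>\<^bsub>AutoGroup grp\<^esub>})
     \<and> (\<forall>R. class_representatives (D' ` {..<q}) (Dsim q e s x) R \<longrightarrow> is_basis (R - {0}) V)
     \<comment> \<open>(iii)\<close>
     \<and> (p > 2 \<and> t = 1 \<and> e = p - 1 \<longrightarrow> (\<exists>B. p_toral_basis p B V))"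
proof -
  interpret cyclic_p'_action p t q x "TYPE('k)" e s E z
    by (intro cyclic_p'_action.intro cyclic_p_group_algebra.intro cyclic_p'_action_axioms.intro)
      (fact p char q t order_P x E e p' z)+
  have one: "\<one>\<^bsub>AutoGroup grp\<^esub> \<in> E" by (rule subgroup.one_closed[OF E])
  have nontrivial: "E \<noteq> {\<one>\<^bsub>AutoGroup grp\<^esub>} \<longleftrightarrow> e \<noteq> 1"
    using one unfolding e by (metis card_1_singletonE is_singletonI is_singleton_altdef singletonD)
  have D'_eq: "D' m = orbit_der (gx (int m - 1))" for m
    by (simp only: D' D_eq)
  have "D' m (gel x) \<in> jacobson_radical" if "E \<noteq> {\<one>\<^bsub>AutoGroup grp\<^esub>}" for m
  proof (rule augmentation_zero_in_jacobson_radical[where q = q and t = t])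
    show "augmentation (D' m (gel x)) = 0"
      using that nontrivial
      by (simp add: D'_eq orbit_der_def der_x augmentation_mult augmentation_orbit_sum)
    show "Factorial_Ring.prime CHAR('k)" by (simp only: char_k prime_p)
    show "q = CHAR('k) ^ t" by (simp only: char_k q_def)
  qed (rule gel_exponent)
  moreover have "\<forall>m<q. \<exists>!d. d \<in> HH1 \<and> d (gel x) = (Dimage q e s x m :: 'g \<Rightarrow>\<^sub>0 'k)"
    using HH1_ex1 by blast
  moreover have "equiv (D' ` {..<q}) (Dsim q e s x)"
    unfolding D' D_image by (rule Dsim_equiv)
  moreover have "\<forall>m<q. D' m = 0 \<longleftrightarrow> m = 1 \<and> E \<noteq> {\<one>\<^bsub>AutoGroup grp\<^esub>}"
    unfolding nontrivial D' using D_eq_0_iff by blast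
  moreover have "is_basis (R - {0}) V"
    if "class_representatives (D' ` {..<q}) (Dsim q e s x) R" for R
    using that unfolding V D' D_image by (rule representatives_basis)
  moreover have "\<exists>B. p_toral_basis p B V" if "p > 2 \<and> t = 1 \<and> e = p - 1"
    using that p_toral_basis_orbit_der unfolding V by blast
  moreover have "lie_subalgebra V"
    unfolding V by (rule HH1_fixed_lie_subalgebra)
  ultimately show ?thesis by blast
qed

end
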